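(* Let $\phi_{(0)},\phi_{(1)}\in\mathbb{R}$ with $\phi_{(0)}\neq 0$ and $\frac{\phi_{(1)}}{\phi_{(0)}}\ge 0$, and suppose that for some $\varepsilon>0$ the inequalities $$p_0(t;w)\ge P(t),\qquad \frac{q_0(t;w)}{p_0(t;w)}\ge Q(t),\qquad R(t)\le r_0(t;w)\le 0$$ hold for all $t\ge t_0$ and all $w\in\mathbb{R}$ with $|w|\le F\bigl(t_0;t;\phi_{(0)};p_0(t_0;\phi_{(0)})\frac{\phi_{(1)}}{\phi_{(0)}}\bigr)+\varepsilon$. Then the solution $\phi_0(t)$ of the equation $$(p_0(t;\phi(t))\phi'(t))'+q_0(t;\phi(t))\phi'(t)+r_0(t;\phi(t))\phi(t)=0,\qquad t\ge t_0,$$ satisfying the initial conditions $\phi_0(t_0)=\phi_{(0)}$, $\phi_0'(t_0)=\phi_{(1)}$, exists on $[t_0;+\infty)$. The function $|\phi_0(t)|$ is positive, nondecreasing and satisfies $$|\phi_0(t)|\le F\Bigl(t_0;t;\phi_{(0)};p_0(t_0;\phi_{(0)})\tfrac{\phi_{(1)}}{\phi_{(0)}}\Bigr),\qquad t\ge t_0.$$ If in addition $\phi_{(1)}\neq 0$, then $\phi_0'(t)\neq 0$ for all $t\ge t_0$.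
   Context: Fix $t_0\in\mathbb{R}$. The functions $p_0(t;w),q_0(t;w),r_0(t;w)$ are real valued and continuous on $[t_0;+\infty)\times(-\infty;+\infty)$, with $p_0(t;w)>0$ everywhere. The functions $P(t),Q(t),R(t)$ are real valued and continuous on $[t_0;+\infty)$, with $P(t)>0$. For $t\ge t_1\ge t_0$ put $$I^+_{P,Q}(t_1;t)=\int_{t_1}^t\exp\Bigl\{-\int_{t_1}^\tau Q(s)\,ds\Bigr\}\frac{d\tau}{P(\tau)},\qquad I^-_{Q,R}(t_1;t)=\int_{t_1}^t\exp\Bigl\{-\int_\tau^t Q(s)\,ds\Bigr\}R(\tau)\,d\tau,$$ $$F(t_1;t;c_1;c_2)=|c_1|\exp\Bigl\{c_2I^+_{P,Q}(t_1;t)-\int_{t_1}^tI^-_{Q,R}(t_1;\tau)\frac{d\tau}{P(\tau)}\Bigr\}.$$ A solution of the equation on an interval is a continuously differentiable function $\phi$ such that $p_0(t;\phi(t))\phi'(t)$ is continuously differentiable and the equation holds. Local solutions always exist (Peano) but need not be unique; "the solution with given initial conditions exists on $[t_0;+\infty)$" means that any solution with these initial conditions which is not extendable to the right is defined on all of $[t_0;+\infty)$. *)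

theory Defs
  imports "HOL-Analysis.Analysis"
begin

definition Iplus :: "(real \<Rightarrow> real) \<Rightarrow> (real \<Rightarrow> real) \<Rightarrow> real \<Rightarrow> real \<Rightarrow> real" where
  "Iplus P Q t1 t = integral {t1..t} (\<lambda>\<tau>. exp (- integral {t1..\<tau>} Q) / P \<tau>)"

definition Iminus :: "(real \<Rightarrow> real) \<Rightarrow> (real \<Rightarrow> real) \<Rightarrow> real \<Rightarrow> real \<Rightarrow> real" where
  "Iminus Q R t1 t = integral {t1..t} (\<lambda>\<tau>. exp (- integral {\<tau>..t} Q) * R \<tau>)"

definition Fbound ::
  "(real \<Rightarrow> real) \<Rightarrow> (real \<Rightarrow> real) \<Rightarrow> (real \<Rightarrow> real) \<Rightarrow> real \<Rightarrow> real \<Rightarrow> real \<Rightarrow> real \<Rightarrow> real" where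
  "Fbound P Q R t1 t c1 c2 =
     \<bar>c1\<bar> * exp (c2 * Iplus P Q t1 t - integral {t1..t} (\<lambda>\<tau>. Iminus Q R t1 \<tau> / P \<tau>))"

text \<open>
  Solutions on an interval \<open>J\<close>, with \<open>\<phi>'\<close> the derivative of \<open>\<phi>\<close>. Derivatives are taken
  within \<open>J\<close>, hence one-sided at endpoints of \<open>J\<close> that belong to it. The function \<open>\<psi>\<close> is the
  derivative of \<open>p0(t; \<phi>(t)) \<phi>'(t)\<close>.
\<close>

definition solution_on ::
  "(real \<Rightarrow> real \<Rightarrow> real) \<Rightarrow> (real \<Rightarrow> real \<Rightarrow> real) \<Rightarrow> (real \<Rightarrow> real \<Rightarrow> real) \<Rightarrow>
   real set \<Rightarrow> (real \<Rightarrow> real) \<Rightarrow> (real \<Rightarrow> real) \<Rightarrow> bool" where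
  "solution_on p0 q0 r0 J \<phi> \<phi>' \<longleftrightarrow>
     (\<forall>t\<in>J. (\<phi> has_real_derivative \<phi>' t) (at t within J)) \<and>
     continuous_on J \<phi>' \<and>
     (\<exists>\<psi>. continuous_on J \<psi> \<and>
        (\<forall>t\<in>J. ((\<lambda>s. p0 s (\<phi> s) * \<phi>' s) has_real_derivative \<psi> t) (at t within J) \<and>
               \<psi> t + q0 t (\<phi> t) * \<phi>' t + r0 t (\<phi> t) * \<phi> t = 0))"

text \<open>
  Nondegenerate intervals with left endpoint \<open>t0\<close>, which belongs to them: \<open>[t0; b]\<close>, \<open>[t0; b)\<close>
  with \<open>b > t0\<close>, and \<open>[t0; +\<infinity>)\<close>. The singleton is excluded because derivatives within it are
  arbitrary.
\<close>

definition right_interval :: "real \<Rightarrow> real set \<Rightarrow> bool" where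
  "right_interval t0 J \<longleftrightarrow> is_interval J \<and> t0 \<in> J \<and> J \<subseteq> {t0..} \<and> J \<noteq> {t0}"

definition ivp_solution_on ::
  "(real \<Rightarrow> real \<Rightarrow> real) \<Rightarrow> (real \<Rightarrow> real \<Rightarrow> real) \<Rightarrow> (real \<Rightarrow> real \<Rightarrow> real) \<Rightarrow>
   real \<Rightarrow> real \<Rightarrow> real \<Rightarrow> real set \<Rightarrow> (real \<Rightarrow> real) \<Rightarrow> (real \<Rightarrow> real) \<Rightarrow> bool" where
  "ivp_solution_on p0 q0 r0 t0 a0 a1 J \<phi> \<phi>' \<longleftrightarrow>
     right_interval t0 J \<and> solution_on p0 q0 r0 J \<phi> \<phi>' \<and> \<phi> t0 = a0 \<and> \<phi>' t0 = a1"

definition nonextendable_ivp_solution_on ::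
  "(real \<Rightarrow> real \<Rightarrow> real) \<Rightarrow> (real \<Rightarrow> real \<Rightarrow> real) \<Rightarrow> (real \<Rightarrow> real \<Rightarrow> real) \<Rightarrow>
   real \<Rightarrow> real \<Rightarrow> real \<Rightarrow> real set \<Rightarrow> (real \<Rightarrow> real) \<Rightarrow> (real \<Rightarrow> real) \<Rightarrow> bool" where
  "nonextendable_ivp_solution_on p0 q0 r0 t0 a0 a1 J \<phi> \<phi>' \<longleftrightarrow>
     ivp_solution_on p0 q0 r0 t0 a0 a1 J \<phi> \<phi>' \<and>
     \<not> (\<exists>J' \<rho> \<rho>'. J \<subset> J' \<and> ivp_solution_on p0 q0 r0 t0 a0 a1 J' \<rho> \<rho>' \<and> (\<forall>t\<in>J. \<rho> t = \<phi> t))"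

text \<open>
  Solutions of the initial value problem need not be unique. That ``the solution exists on
  \<open>[t0; +\<infinity>)\<close>'' means that every solution not extendable to the right is defined on all of
  \<open>[t0; +\<infinity>)\<close>. The first conjunct makes explicit that there is such a solution at all (Peano).
\<close>

definition ivp_exists_globally ::
  "(real \<Rightarrow> real \<Rightarrow> real) \<Rightarrow> (real \<Rightarrow> real \<Rightarrow> real) \<Rightarrow> (real \<Rightarrow> real \<Rightarrow> real) \<Rightarrow>
   real \<Rightarrow> real \<Rightarrow> real \<Rightarrow> bool" where
  "ivp_exists_globally p0 q0 r0 t0 a0 a1 \<longleftrightarrow>
     (\<exists>J \<phi> \<phi>'. nonextendable_ivp_solution_on p0 q0 r0 t0 a0 a1 J \<phi> \<phi>') \<and>
     (\<forall>J \<phi> \<phi>'. nonextendable_ivp_solution_on p0 q0 r0 t0 a0 a1 J \<phi> \<phi>' \<longrightarrow> J = {t0..})"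

end

theory Submission imports Defs begin

text \<open>
  The equation is the first-order system \<open>\<phi>' = u / p0(t; \<phi>)\<close>,
  \<open>u' = - (q0 / p0)(t; \<phi>) u - r0(t; \<phi>) \<phi>\<close>, which is linear along a given solution. As \<open>r0 \<le> 0\<close>,
  \<open>\<phi>\<close> and \<open>u\<close> keep the sign of \<open>\<phi>(t0)\<close>, so \<open>y = u / \<phi> \<ge> 0\<close>, and its Riccati equation gives
  \<open>y' \<le> - Q y - R\<close>. Integrating this twice yields \<open>\<bar>\<phi>\<bar> \<le> F\<close>. The coefficient inequalities hold
  only for \<open>\<bar>\<phi>\<bar> \<le> F + \<epsilon>\<close>, but since the conclusion is the stronger \<open>\<bar>\<phi>\<bar> \<le> F\<close>, a continuity
  argument closes the loop. Clamping the argument \<open>\<phi>\<close> of the coefficients to \<open>[- F - \<epsilon>, F + \<epsilon>]\<close>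
  gives a system of linear growth that has the same solutions and, by Peano's theorem, global ones;
  following such a solution from the right endpoint of an interval extends any given solution to
  \<open>[t0; +\<infinity>)\<close>.
\<close>

subsection \<open>Peano's theorem\<close>

text \<open>By the pointwise bounds all \<open>Y n\<close> lie in a product of closed balls, compact
  for pointwise convergence by Tychonoff's theorem, so the sequence has a cluster point. The index
  set is arbitrary and a convergent subsequence need not exist; hence the index \<open>n\<close>
  depends on the finite set \<open>T\<close> and on \<open>e\<close>.\<close>

lemma pointwise_cluster_point:
  fixes Y :: "nat \<Rightarrow> 'a \<Rightarrow> 'b::euclidean_space"
  assumes "\<And>t. \<exists>B. \<forall>n. norm (Y n t) \<le> B"
  obtains y where "\<And>T e N. finite T \<Longrightarrow> e > 0 \<Longrightarrow> \<exists>n\<ge>N. \<forall>t\<in>T. norm (Y n t - y t) < e"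
proof -
  obtain B where B: "\<And>t n. norm (Y n t) \<le> B t"
    using assms by metis
  define K where "K = PiE UNIV (\<lambda>t. cball (0::'b) (B t))"
  have "compactin (product_topology (\<lambda>_. euclidean) UNIV) K"
    unfolding K_def by (subst compactin_PiE) auto
  then have "compact K"
    by (simp add: euclidean_product_topology)
  moreover have "filtermap Y sequentially \<noteq> bot"
    by (simp add: filtermap_bot_iff)
  moreover have "eventually (\<lambda>g. g \<in> K) (filtermap Y sequentially)"
    by (simp add: eventually_filtermap K_def PiE_def extensional_def B)
  ultimately obtain y where y: "inf (nhds y) (filtermap Y sequentially) \<noteq> bot"
    unfolding compact_filter by blast
  show thesis
  proof (rule that, rule ccontr)
    fix T :: "'a set" and e :: real and N
    assume T: "finite T" and e: "e > 0"
      and contra: "\<not> (\<exists>n\<ge>N. \<forall>t\<in>T. norm (Y n t - y t) < e)"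
    have "eventually (\<lambda>g. dist (g t) (y t) < e) (nhds y)" for t
    proof -
      have "((\<lambda>g. g t) \<longlongrightarrow> y t) (at y)"
        using continuous_on_product_coordinates[of t, where ?'b = 'b]
        by (simp add: continuous_on_def)
      then have "((\<lambda>g. g t) \<longlongrightarrow> y t) (nhds y)"
        using tendsto_at_iff_tendsto_nhds[of "\<lambda>g. g t" y] by simp
      then show ?thesis
        using e by (rule tendstoD)
    qed
    then have "eventually (\<lambda>g. \<forall>t\<in>T. dist (g t) (y t) < e) (nhds y)"
      using T by (simp add: eventually_ball_finite_distrib)
    moreover have "eventually (\<lambda>g. \<not> (\<forall>t\<in>T. dist (g t) (y t) < e)) (filtermap Y sequentially)"
      unfolding eventually_filtermap eventually_sequentially
      using contra by (auto simp: dist_norm intro!: exI[of _ N])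
    ultimately have "eventually (\<lambda>_. False) (inf (nhds y) (filtermap Y sequentially))"
      unfolding eventually_inf by blast
    then show False
      using y by (simp add: trivial_limit_def)
  qed
qed

section \<open>Euler polygons and their increments\<close>

primrec euler_node :: "(real \<Rightarrow> 'a::real_normed_vector \<Rightarrow> 'a) \<Rightarrow> real \<Rightarrow> real \<Rightarrow> 'a \<Rightarrow> nat \<Rightarrow> 'a" where
  "euler_node f a h x0 0 = x0"
| "euler_node f a h x0 (Suc k) =
     euler_node f a h x0 k + h *\<^sub>R f (a + real k * h) (euler_node f a h x0 k)"

definition ramp :: "real \<Rightarrow> real \<Rightarrow> real \<Rightarrow> nat \<Rightarrow> real" where
  "ramp a h t k = max 0 (min h (t - (a + real k * h)))"

text \<open>The Euler polygon with \<open>N\<close> steps of length \<open>h\<close>, as a sum of its increments over the steps: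
  \<open>ramp a h t k\<close> is the time spent in the step \<open>k\<close> before \<open>t\<close>.\<close>

definition euler :: "(real \<Rightarrow> 'a::real_normed_vector \<Rightarrow> 'a) \<Rightarrow> real \<Rightarrow> real \<Rightarrow> 'a \<Rightarrow> nat \<Rightarrow> real \<Rightarrow> 'a" where
  "euler f a h x0 N t =
     x0 + (\<Sum>k<N. ramp a h t k *\<^sub>R f (a + real k * h) (euler_node f a h x0 k))"

lemma ramp_mono: "s \<le> t \<Longrightarrow> ramp a h s k \<le> ramp a h t k"
  by (auto simp: ramp_def)

lemma sum_ramp:
  assumes "h > 0" "t \<ge> a"
  shows "(\<Sum>k<N. ramp a h t k) = min (real N * h) (t - a)"
  using assms by (induction N) (auto simp: ramp_def algebra_simps min_def max_def)

text \<open>Purpose: only steps that overlap the time from \<open>s\<close> to \<open>t\<close>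
  contribute to the increment of the polygon between these times.\<close>

lemma ramp_diff_nonzero:
  assumes "ramp a h t k \<noteq> ramp a h s k" "s \<le> t"
  shows "a + real k * h < t" "s < a + real k * h + h"
  using assms by (auto simp: ramp_def min_def max_def split: if_splits)

lemma euler_node_eq_sum:
  "euler_node f a h x0 k = x0 + (\<Sum>j<k. h *\<^sub>R f (a + real j * h) (euler_node f a h x0 j))"
  by (induction k) (auto simp: algebra_simps)

text \<open>At node \<open>k\<close> the ramps of the steps before \<open>k\<close> are full and all
  others are still zero.\<close>

lemma euler_at_node:
  assumes "h > 0" "k \<le> N"
  shows "euler f a h x0 N (a + real k * h) = euler_node f a h x0 k"
proof -
  let ?F = "\<lambda>j. f (a + real j * h) (euler_node f a h x0 j)"
  have "ramp a h (a + real k * h) j = (if j < k then h else 0)" for j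
  proof (cases "j < k")
    case True
    then have "real j + 1 \<le> real k"
      by linarith
    then have "(real j + 1) * h \<le> real k * h"
      using assms(1) by (intro mult_right_mono) auto
    then show ?thesis
      using True assms(1) by (auto simp: ramp_def algebra_simps)
  next
    case False
    then have "real k * h \<le> real j * h"
      using assms(1) by (intro mult_right_mono) auto
    then show ?thesis
      using False by (simp add: ramp_def)
  qed
  then have "(\<Sum>j<N. ramp a h (a + real k * h) j *\<^sub>R ?F j) = (\<Sum>j<N. if j < k then h *\<^sub>R ?F j else 0)"
    by (intro sum.cong) auto
  also have "\<dots> = (\<Sum>j\<in>{..<N} \<inter> {j. j < k}. h *\<^sub>R ?F j)"
    by (simp add: sum.If_cases)
  also have "{..<N} \<inter> {j. j < k} = {..<k}"
    using assms(2) by auto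
  finally show ?thesis
    by (simp add: euler_def euler_node_eq_sum[of f a h x0 k])
qed

text \<open>The increment is a sum of slopes with nonnegative weights, the ramp differences, whose
  total is \<open>t - s\<close>; slopes within \<open>e\<close> of \<open>v\<close> therefore
  average to within \<open>e\<close> of \<open>v\<close>. With \<open>v = 0\<close> this gives
  Lipschitz bounds, with \<open>v\<close> the value of the field at a limit point it gives the
  differential equation.\<close>

lemma euler_increment:
  assumes "h > 0" "a \<le> s" "s \<le> t" "t \<le> a + real N * h"
    and F: "\<And>k. k < N \<Longrightarrow> a + real k * h < t \<Longrightarrow> s < a + real k * h + h \<Longrightarrow>
              norm (f (a + real k * h) (euler_node f a h x0 k) - v) \<le> e"
  shows "norm (euler f a h x0 N t - euler f a h x0 N s - (t - s) *\<^sub>R v) \<le> (t - s) * e"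
proof -
  let ?F = "\<lambda>k. f (a + real k * h) (euler_node f a h x0 k)"
  let ?w = "\<lambda>k. ramp a h t k - ramp a h s k"
  have w: "(\<Sum>k<N. ?w k) = t - s"
    using assms by (simp add: sum_subtractf sum_ramp)
  have eq: "euler f a h x0 N t - euler f a h x0 N s - (t - s) *\<^sub>R v = (\<Sum>k<N. ?w k *\<^sub>R (?F k - v))"
    unfolding w[symmetric] euler_def
    by (simp add: sum_subtractf scaleR_sum_left scaleR_diff_right scaleR_diff_left)
  have "norm (\<Sum>k<N. ?w k *\<^sub>R (?F k - v)) \<le> (\<Sum>k<N. ?w k * e)"
  proof (rule sum_norm_le)
    fix k assume k: "k \<in> {..<N}"
    show "norm (?w k *\<^sub>R (?F k - v)) \<le> ?w k * e"
    proof (cases "?w k = 0")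
      case False
      then have "norm (?F k - v) \<le> e"
        using ramp_diff_nonzero[of a h t k s] assms(3) k by (intro F) auto
      then show ?thesis
        using ramp_mono[OF assms(3), of a h k] by (simp add: mult_left_mono)
    qed simp
  qed
  also have "\<dots> = (t - s) * e"
    using w by (simp add: sum_distrib_right[symmetric])
  finally show ?thesis
    unfolding eq .
qed

text \<open>Discrete Gronwall estimate: a step multiplies \<open>1 + norm\<close> by at most
  \<open>1 + M * h\<close>, which is at most \<open>exp (M * h)\<close>. The node may lie as far as
  \<open>b + h\<close>, since the last slope entering it is taken one step earlier.\<close>

lemma norm_euler_node_le:
  assumes h: "h > 0" and M: "\<And>t x. a \<le> t \<Longrightarrow> t \<le> b \<Longrightarrow> norm (f t x) \<le> M * (1 + norm x)" and "M \<ge> 0"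
    and "a + real k * h \<le> b + h"
  shows "1 + norm (euler_node f a h x0 k) \<le> (1 + norm x0) * exp (M * (real k * h))"
  using assms(4)
proof (induction k)
  case (Suc k)
  let ?y = "euler_node f a h x0 k"
  have b: "a + real k * h \<le> b"
    using Suc.prems by (simp add: algebra_simps)
  have "norm (euler_node f a h x0 (Suc k)) \<le> norm ?y + norm (h *\<^sub>R f (a + real k * h) ?y)"
    unfolding euler_node.simps by (rule norm_triangle_ineq)
  also have "norm (h *\<^sub>R f (a + real k * h) ?y) \<le> h * (M * (1 + norm ?y))"
    using h M[of "a + real k * h" ?y] b by (simp add: mult_left_mono)
  finally have "1 + norm (euler_node f a h x0 (Suc k)) \<le> (1 + M * h) * (1 + norm ?y)"
    by (simp add: algebra_simps)
  also have "\<dots> \<le> exp (M * h) * ((1 + norm x0) * exp (M * (real k * h)))"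
    using Suc.IH b h \<open>M \<ge> 0\<close> by (intro mult_mono exp_ge_add_one_self) auto
  also have "\<dots> = (1 + norm x0) * exp (M * (real (Suc k) * h))"
    by (simp add: algebra_simps exp_add)
  finally show ?case .
qed simp

text \<open>Peano's theorem. Pointwise boundedness and Tychonoff's theorem give a pointwise cluster point
  of the Euler polygons; since they are locally uniformly Lipschitz, closeness at two points
  \<open>s\<close> and \<open>t\<close> already controls the difference quotient of the cluster point.\<close>

theorem peano_linear_growth:
  fixes f :: "real \<Rightarrow> 'a::euclidean_space \<Rightarrow> 'a"
  assumes cont: "continuous_on ({a..} \<times> UNIV) (\<lambda>(t, x). f t x)"
    and growth: "\<And>b. \<exists>M. \<forall>t\<in>{a..b}. \<forall>x. norm (f t x) \<le> M * (1 + norm x)"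
  obtains y where "y a = x0"
    and "\<And>t. t \<ge> a \<Longrightarrow> (y has_vector_derivative f t (y t)) (at t within {a..})"
proof -
  \<comment> \<open>The mesh \<open>h n\<close> tends to 0 while \<open>N n\<close> steps cover a
    time span of length \<open>n + 1\<close>, so the polygons exhaust the half-line.\<close>
  define h where "h n = 1 / real (Suc n)" for n
  define N where "N n = Suc n * Suc n" for n
  have h: "h n > 0" for n
    by (simp add: h_def)
  have Nh: "real (N n) * h n = real (Suc n)" for n
    unfolding N_def h_def of_nat_mult by (simp del: of_nat_Suc)
  define node where "node n = euler_node f a (h n) x0" for n
  define Y where "Y n = euler f a (h n) x0 (N n)" for n
  have "\<exists>C\<ge>0. \<forall>n k. a + real k * h n \<le> b \<longrightarrow> norm (f (a + real k * h n) (node n k)) \<le> C" for b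
  proof (cases "a \<le> b")
    case True
    obtain M where M: "\<And>t x. a \<le> t \<Longrightarrow> t \<le> b \<Longrightarrow> norm (f t x) \<le> M * (1 + norm x)"
      using growth[of b] by (meson atLeastAtMost_iff)
    have "0 \<le> M * (1 + norm x0)"
      using M[of a x0] True norm_ge_zero order_trans by blast
    then have M0: "M \<ge> 0"
      by (smt (verit) norm_ge_zero zero_le_mult_iff)
    define C where "C = M * ((1 + norm x0) * exp (M * (b - a)))"
    have "norm (f (a + real k * h n) (node n k)) \<le> C" if k: "a + real k * h n \<le> b" for n k
    proof -
      have "norm (f (a + real k * h n) (node n k)) \<le> M * (1 + norm (node n k))"
        using M k h[of n] by simp
      also have "1 + norm (node n k) \<le> (1 + norm x0) * exp (M * (real k * h n))"
        unfolding node_def using h[of n] M M0 k by (intro norm_euler_node_le) auto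
      also have "\<dots> \<le> (1 + norm x0) * exp (M * (b - a))"
        using k M0 by (intro mult_left_mono) (auto intro!: mult_left_mono)
      finally show ?thesis
        using M0 by (simp add: C_def mult_left_mono)
    qed
    moreover have "C \<ge> 0"
      using M0 by (simp add: C_def)
    ultimately show ?thesis
      by blast
  next
    case False
    have "\<not> a + real k * h n \<le> b" for n k
      using False h[of n] by (smt (verit) mult_nonneg_nonneg of_nat_0_le_iff)
    then show ?thesis
      by (intro exI[of _ 0]) auto
  qed
  then obtain C where C0: "\<And>b. C b \<ge> 0"
    and C: "\<And>b n k. a + real k * h n \<le> b \<Longrightarrow> norm (f (a + real k * h n) (node n k)) \<le> C b"
    by metis
  have lip: "norm (Y n t - Y n s) \<le> C b * (t - s)"
    if "a \<le> s" "s \<le> t" "t \<le> b" "t \<le> a + real (Suc n)" for n s t b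
  proof -
    have "norm (Y n t - Y n s - (t - s) *\<^sub>R 0) \<le> (t - s) * C b"
      unfolding Y_def
    proof (rule euler_increment[OF h])
      show "norm (f (a + real k * h n) (euler_node f a (h n) x0 k) - 0) \<le> C b"
        if "a + real k * h n < t" for k
        using C[of k n b] that \<open>t \<le> b\<close> by (simp add: node_def)
    qed (use that in \<open>auto simp: Nh\<close>)
    then show ?thesis
      by (simp add: mult.commute)
  qed
  have Ya: "Y n a = x0" for n
    using euler_at_node[OF h, of 0 "N n" f a n x0] by (simp add: Y_def)
  \<comment> \<open>The bound \<open>lip\<close> is available only on the time range covered by the
    \<open>n\<close>-th polygon. The default 0 elsewhere is harmless for boundedness and, at a given
    time after \<open>a\<close>, concerns only finitely many \<open>n\<close>.\<close>
  define Z where "Z n t = (if a \<le> t \<and> t \<le> a + real (Suc n) then Y n t else 0)" for n t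
  have "\<exists>B. \<forall>n. norm (Z n t) \<le> B" for t
  proof (intro exI[of _ "norm x0 + C t * \<bar>t - a\<bar>"] allI)
    fix n
    show "norm (Z n t) \<le> norm x0 + C t * \<bar>t - a\<bar>"
      using lip[of a t t n] norm_triangle_sub[of "Y n t" "Y n a"] C0[of t] by (auto simp: Ya Z_def)
  qed
  then obtain y where y: "\<And>T e m. finite T \<Longrightarrow> e > 0 \<Longrightarrow>
      \<exists>n\<ge>m. \<forall>t\<in>T. norm (Z n t - y t) < e"
    using pointwise_cluster_point[of Z] by blast
  have cluster: "\<exists>n\<ge>m. norm (Y n s - y s) < e \<and> norm (Y n t - y t) < e \<and>
      s \<le> a + real (Suc n) \<and> t \<le> a + real (Suc n)"
    if "e > 0" "a \<le> s" "a \<le> t" for m e s t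
  proof -
    \<comment> \<open>Starting the search at this index puts \<open>s\<close> and \<open>t\<close>
      into the range where \<open>Z n\<close> is the polygon.\<close>
    obtain n where n: "n \<ge> max m (nat \<lceil>max s t - a\<rceil>)"
      "\<forall>t\<in>{s, t}. norm (Z n t - y t) < e"
      using y[of "{s, t}" e] \<open>e > 0\<close> by blast
    have "max s t \<le> a + real (Suc n)"
      using n(1) by linarith
    then show ?thesis
      using n that by (intro exI[of _ n]) (auto simp: Z_def)
  qed
  have "norm (x0 - y a) < e" if "e > 0" for e
    using cluster[of e a a 0] that by (auto simp: Ya)
  then have ya: "y a = x0"
    by (metis less_irrefl norm_minus_commute right_minus_eq zero_less_norm_iff)
  have "(y has_vector_derivative f s (y s)) (at s within {a..})" if s: "s \<ge> a" for s
    unfolding has_vector_derivative_def has_derivative_within_alt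
  proof (intro conjI allI impI bounded_linear_scaleR_left)
    fix e :: real assume e: "e > 0"
    let ?v = "f s (y s)"
    obtain \<delta> where \<delta>: "\<delta> > 0"
      "\<And>t x. t \<ge> a \<Longrightarrow> dist (t, x) (s, y s) < \<delta> \<Longrightarrow> norm (f t x - ?v) < e"
      using cont[unfolded continuous_on_iff, rule_format, of "(s, y s)" e] s e
      by (auto simp: dist_norm)
    define c where "c = C (s + 1)"
    \<comment> \<open>The nodes that matter lie within \<open>2 * \<eta>\<close> of
      \<open>s\<close>. The bound 1/2 keeps them before \<open>s + 1\<close>, where \<open>c\<close>
      is a Lipschitz constant; the other bound makes \<open>2 * \<eta> + 2 * \<eta> * c\<close> at
      most a quarter of \<open>\<delta>\<close>, and the distance of \<open>Y n s\<close> from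
      \<open>y s\<close> takes another quarter.\<close>
    define \<eta> where "\<eta> = min (1/2) (\<delta> / (8 * (c + 1)))"
    have c: "c \<ge> 0"
      using C0 by (simp add: c_def)
    have \<eta>: "\<eta> > 0" "\<eta> \<le> 1/2"
      unfolding \<eta>_def using \<delta>(1) c by (simp, intro min.cobounded1)
    have "\<eta> \<le> \<delta> / (8 * (c + 1))"
      unfolding \<eta>_def by simp
    then have "\<eta> * (8 * (c + 1)) \<le> \<delta>"
      using c by (simp add: pos_le_divide_eq)
    then have \<eta>c: "8 * \<eta> * c + 8 * \<eta> \<le> \<delta>"
      by (simp add: algebra_simps)
    have \<eta>c0: "\<eta> * c \<ge> 0"
      using \<eta> c by simp
    have key: "norm (y t - y s - (t - s) *\<^sub>R ?v) \<le> e * \<bar>t - s\<bar>" if t: "t \<ge> a" "\<bar>t - s\<bar> < \<eta>" for t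
    \<comment> \<open>The cluster point gives closeness only at finitely many points, and
      \<open>s\<close> and \<open>t\<close> are enough: the error there is absorbed in
      \<open>\<gamma>\<close>, so \<open>n\<close> may depend on \<open>t\<close> and
      \<open>\<gamma>\<close>.\<close>
    proof (rule field_le_epsilon)
      fix \<gamma> :: real assume \<gamma>: "\<gamma> > 0"
      define lo hi where "lo = min s t" and "hi = max s t"
      obtain m where m: "inverse (real (Suc m)) < \<eta>"
        using reals_Archimedean[OF \<eta>(1)] by auto
      have "min (\<gamma> / 2) (\<delta> / 4) > 0"
        using \<gamma> \<delta> by simp
      then obtain n where n: "n \<ge> m" "norm (Y n s - y s) < min (\<gamma> / 2) (\<delta> / 4)"
        "norm (Y n t - y t) < min (\<gamma> / 2) (\<delta> / 4)" "s \<le> a + real (Suc n)" "t \<le> a + real (Suc n)"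
        using cluster[of "min (\<gamma> / 2) (\<delta> / 4)" s t m] s t by blast
      have "h n \<le> inverse (real (Suc m))"
        using n(1) by (simp add: h_def inverse_eq_divide frac_le)
      then have hn: "h n < \<eta>"
        using m by simp
      have "norm (Y n hi - Y n lo - (hi - lo) *\<^sub>R ?v) \<le> (hi - lo) * e"
        unfolding Y_def
      proof (rule euler_increment[OF h])
        fix k assume k: "k < N n" "a + real k * h n < hi" "lo < a + real k * h n + h n"
        let ?t = "a + real k * h n"
        \<comment> \<open>A step overlapping the interval may start before \<open>lo\<close>, by
          less than \<open>h n\<close>; hence twice \<open>\<eta>\<close>.\<close>
        have t': "\<bar>?t - s\<bar> < 2 * \<eta>"
          using k(2,3) t(2) hn \<eta> unfolding lo_def hi_def by linarith
        have ta: "?t \<ge> a"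
          using h[of n] by simp
        have tn: "?t \<le> a + real (Suc n)"
          using k(2) n(4,5) unfolding hi_def by linarith
        have "norm (node n k - Y n s) = norm (Y n ?t - Y n s)"
          unfolding Y_def node_def euler_at_node[OF h less_imp_le[OF k(1)]] ..
        also have "\<dots> \<le> c * \<bar>?t - s\<bar>"
        proof (cases "s \<le> ?t")
          case True
          then show ?thesis
            using lip[of s ?t "s + 1" n] s tn t' \<eta> by (simp add: c_def)
        next
          case False
          then show ?thesis
            using lip[of ?t s "s + 1" n] ta n(4) by (simp add: c_def norm_minus_commute)
        qed
        also have "\<dots> \<le> c * (2 * \<eta>)"
          using c t' by (intro mult_left_mono) auto
        finally have "norm (node n k - y s) \<le> 2 * (\<eta> * c) + \<delta> / 4"
          using n(2) norm_triangle_ineq[of "node n k - Y n s" "Y n s - y s"]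
          by (simp add: mult.commute[of c])
        moreover have "dist (?t, node n k) (s, y s) \<le> dist ?t s + dist (node n k) (y s)"
          unfolding dist_Pair_Pair by (rule sqrt_sum_squares_le_sum) auto
        ultimately have "dist (?t, node n k) (s, y s) < \<delta>"
          using t' \<eta>c \<eta>c0 \<delta>(1) by (simp add: dist_norm algebra_simps)
        then show "norm (f ?t (euler_node f a (h n) x0 k) - ?v) \<le> e"
          using \<delta>(2)[OF ta, of "node n k"] by (simp add: node_def)
      qed (use s t n in \<open>auto simp: lo_def hi_def Nh\<close>)
      note * = this
      have "norm (Y n t - Y n s - (t - s) *\<^sub>R ?v) \<le> e * \<bar>t - s\<bar>"
      proof (cases "s \<le> t")
        case False
        have "Y n t - Y n s - (t - s) *\<^sub>R ?v = - (Y n s - Y n t - (s - t) *\<^sub>R ?v)"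
          by (simp add: algebra_simps)
        then show ?thesis
          using * False by (simp only: norm_minus_cancel) (simp add: lo_def hi_def mult.commute)
      qed (use * in \<open>simp add: lo_def hi_def mult.commute\<close>)
      moreover have "y t - y s - (t - s) *\<^sub>R ?v =
          (Y n t - Y n s - (t - s) *\<^sub>R ?v) - (Y n t - y t) + (Y n s - y s)"
        by simp
      then have "norm (y t - y s - (t - s) *\<^sub>R ?v) \<le>
          norm (Y n t - Y n s - (t - s) *\<^sub>R ?v) + norm (Y n t - y t) + norm (Y n s - y s)"
        by (simp only:) (intro norm_triangle_mono norm_triangle_le_diff order_refl)
      ultimately show "norm (y t - y s - (t - s) *\<^sub>R ?v) \<le> e * \<bar>t - s\<bar> + \<gamma>"
        using n(2,3) by simp
    qed
    show "\<exists>d>0. \<forall>t\<in>{a..}. norm (t - s) < d \<longrightarrow>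
        norm (y t - y s - (t - s) *\<^sub>R ?v) \<le> e * norm (t - s)"
      using key \<eta>(1) by (intro exI[of _ \<eta>]) auto
  qed
  then show thesis
    using ya that by blast
qed

subsection \<open>Riccati comparison for linear systems\<close>

lemma nondecreasing_if_deriv_nonneg:
  fixes f :: "real \<Rightarrow> real"
  assumes "\<And>t. t \<in> {a..b} \<Longrightarrow> (f has_real_derivative f' t) (at t within {a..b})"
    and "\<And>t. t \<in> {a<..<b} \<Longrightarrow> f' t \<ge> 0" and "a \<le> s" "s \<le> t" "t \<le> b"
  shows "f s \<le> f t"
proof (rule DERIV_nonneg_imp_increasing_open[OF \<open>s \<le> t\<close>])
  show "\<exists>y. (f has_real_derivative y) (at x) \<and> 0 \<le> y" if "s < x" "x < t" for x
    using assms(1)[of x] assms(2)[of x] that \<open>a \<le> s\<close> \<open>t \<le> b\<close>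
    by (auto simp: at_within_Icc_at)
  have "continuous_on {a..b} f"
    using assms(1) by (intro DERIV_continuous_on)
  then show "continuous_on {s..t} f"
    by (rule continuous_on_subset) (use assms in auto)
qed

lemma has_field_derivative_eq_on:
  assumes "(f has_field_derivative D) (at t within S)" "\<And>s. s \<in> S \<Longrightarrow> g s = f s" "t \<in> S"
  shows "(g has_field_derivative D) (at t within S)"
  using assms unfolding has_field_derivative_def by (blast intro: has_derivative_transform)

section \<open>The bound F in terms of a linear Riccati majorant\<close>

text \<open>Splitting the inner integral at \<open>\<tau>\<close> moves the dependence on
  \<open>t\<close> out of the integrand, so that the fundamental theorem of calculus can be
  applied.\<close>

lemma Iminus_eq:
  assumes Q: "continuous_on {a..} Q" and "a \<le> t"
  shows "Iminus Q R a t = exp (- integral {a..t} Q) * integral {a..t} (\<lambda>\<tau>. exp (integral {a..\<tau>} Q) * R \<tau>)"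
proof -
  have "Iminus Q R a t = integral {a..t} (\<lambda>\<tau>. exp (- integral {a..t} Q) * (exp (integral {a..\<tau>} Q) * R \<tau>))"
    unfolding Iminus_def
  proof (rule integral_cong)
    fix \<tau> assume \<tau>: "\<tau> \<in> {a..t}"
    have "Q integrable_on {a..t}"
      using Q by (intro integrable_continuous_real) (auto intro: continuous_on_subset)
    then have "integral {a..\<tau>} Q + integral {\<tau>..t} Q = integral {a..t} Q"
      using \<tau> by (intro Henstock_Kurzweil_Integration.integral_combine) auto
    then have "- integral {\<tau>..t} Q = - integral {a..t} Q + integral {a..\<tau>} Q"
      by simp
    then show "exp (- integral {\<tau>..t} Q) * R \<tau> =
        exp (- integral {a..t} Q) * (exp (integral {a..\<tau>} Q) * R \<tau>)"
      by (simp only: exp_add mult.assoc)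
  qed
  then show ?thesis
    by simp
qed

text \<open>Variation of constants: the solution of \<open>y' = - Q y - R\<close> with value
  \<open>c\<close> at \<open>a\<close>.\<close>

definition riccati_bound :: "(real \<Rightarrow> real) \<Rightarrow> (real \<Rightarrow> real) \<Rightarrow> real \<Rightarrow> real \<Rightarrow> real \<Rightarrow> real" where
  "riccati_bound Q R a c t = c * exp (- integral {a..t} Q) - Iminus Q R a t"

lemma integral_deriv_atLeast:
  fixes Q :: "real \<Rightarrow> real"
  assumes "continuous_on {a..} Q" "t \<in> {a..b}"
  shows "((\<lambda>t. integral {a..t} Q) has_real_derivative Q t) (at t within {a..b})"
  using assms by (intro integral_has_real_derivative) (auto intro: continuous_on_subset)

lemma riccati_bound_deriv:
  assumes Q: "continuous_on {a..} Q" and R: "continuous_on {a..} R" and t: "t \<in> {a..b}"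
  shows "(riccati_bound Q R a c has_real_derivative - Q t * riccati_bound Q R a c t - R t) (at t within {a..b})"
proof -
  let ?A = "\<lambda>t. integral {a..t} Q"
  let ?J = "\<lambda>t. integral {a..t} (\<lambda>\<tau>. exp (?A \<tau>) * R \<tau>)"
  have A: "(?A has_real_derivative Q t) (at t within {a..b})" if "t \<in> {a..b}" for t
    using Q that by (rule integral_deriv_atLeast)
  have "continuous_on {a..b} ?A"
    using A by (intro DERIV_continuous_on)
  then have J: "(?J has_real_derivative exp (?A t) * R t) (at t within {a..b})"
    using R t by (intro integral_has_real_derivative continuous_intros) (auto intro: continuous_on_subset)
  have eq: "riccati_bound Q R a c t = exp (- ?A t) * (c - ?J t)" if "t \<in> {a..b}" for t
    using that by (simp add: riccati_bound_def Iminus_eq[OF Q] algebra_simps)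
  have "((\<lambda>t. exp (- ?A t) * (c - ?J t)) has_real_derivative
      - Q t * (exp (- ?A t) * (c - ?J t)) - R t) (at t within {a..b})"
    by (rule derivative_eq_intros A[OF t] J refl | simp)+ (simp add: algebra_simps exp_minus)
  then show ?thesis
    unfolding eq[OF t, symmetric] using eq t by (rule has_field_derivative_eq_on)
qed

lemma continuous_on_atLeast_if_Icc:
  fixes f :: "real \<Rightarrow> 'a::topological_space"
  assumes "\<And>b. continuous_on {a..b} f"
  shows "continuous_on {a..} f"
proof -
  have "continuous (at t within {a..}) f" if "t \<ge> a" for t
  proof -
    have "continuous (at t within {a..t+1}) f"
      using assms[of "t + 1"] that by (simp add: continuous_on_eq_continuous_within)
    moreover have "at t within {a..t+1} = at t within {a..}"
      by (rule at_within_nhd[of _ "{..<t+1}"]) auto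
    ultimately show ?thesis
      by simp
  qed
  then show ?thesis
    by (simp add: continuous_on_eq_continuous_within)
qed

text \<open>By linearity the two integrals in the exponent merge into one. In this form the
  logarithmic derivative of the bound is \<open>riccati_bound / P\<close>, which can be compared
  with the logarithmic derivative of a solution.\<close>

lemma Fbound_eq:
  assumes P: "continuous_on {a..} P" and Q: "continuous_on {a..} Q" and R: "continuous_on {a..} R"
    and pos: "\<And>t. t \<ge> a \<Longrightarrow> P t > 0" and "a \<le> t"
  shows "Fbound P Q R a t c1 c = \<bar>c1\<bar> * exp (integral {a..t} (\<lambda>\<tau>. riccati_bound Q R a c \<tau> / P \<tau>))"
proof -
  have P': "continuous_on {a..t} P" "\<forall>x\<in>{a..t}. P x \<noteq> 0"
    using P pos by (force intro: continuous_on_subset)+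
  have E: "continuous_on {a..t} (\<lambda>\<tau>. exp (- integral {a..\<tau>} Q))"
    by (intro continuous_intros indefinite_integral_continuous_1 integrable_continuous_real
        continuous_on_subset[OF Q]) auto
  have "continuous_on {a..t} (riccati_bound Q R a c)"
    by (rule DERIV_continuous_on[OF riccati_bound_deriv[OF Q R]])
  then have "continuous_on {a..t} (\<lambda>\<tau>. c * exp (- integral {a..\<tau>} Q) - riccati_bound Q R a c \<tau>)"
    using E by (intro continuous_on_diff continuous_on_mult_left)
  then have I: "continuous_on {a..t} (Iminus Q R a)"
    by (simp add: riccati_bound_def)
  have "integral {a..t} (\<lambda>\<tau>. riccati_bound Q R a c \<tau> / P \<tau>) =
      integral {a..t} (\<lambda>\<tau>. c * (exp (- integral {a..\<tau>} Q) / P \<tau>) - Iminus Q R a \<tau> / P \<tau>)"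
    by (simp add: riccati_bound_def diff_divide_distrib)
  also have "\<dots> = integral {a..t} (\<lambda>\<tau>. c * (exp (- integral {a..\<tau>} Q) / P \<tau>))
      - integral {a..t} (\<lambda>\<tau>. Iminus Q R a \<tau> / P \<tau>)"
    by (intro Henstock_Kurzweil_Integration.integral_diff integrable_continuous_real
        continuous_on_mult_left continuous_on_divide E I P')
  also have "integral {a..t} (\<lambda>\<tau>. c * (exp (- integral {a..\<tau>} Q) / P \<tau>)) = c * Iplus P Q a t"
    unfolding Iplus_def by (rule integral_mult_right)
  finally show ?thesis
    by (simp add: Fbound_def)
qed

lemma continuous_on_Fbound:
  assumes P: "continuous_on {a..} P" and Q: "continuous_on {a..} Q" and R: "continuous_on {a..} R"
    and pos: "\<And>t. t \<ge> a \<Longrightarrow> P t > 0"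
  shows "continuous_on {a..} (\<lambda>t. Fbound P Q R a t c1 c)"
proof (rule continuous_on_atLeast_if_Icc)
  fix b
  have "continuous_on {a..b} (\<lambda>\<tau>. riccati_bound Q R a c \<tau> / P \<tau>)"
    using pos by (intro continuous_on_divide continuous_on_subset[OF P]
        DERIV_continuous_on[OF riccati_bound_deriv[OF Q R]]) force+
  then have "continuous_on {a..b} (\<lambda>t. \<bar>c1\<bar> * exp (integral {a..t} (\<lambda>\<tau>. riccati_bound Q R a c \<tau> / P \<tau>)))"
    by (intro continuous_on_mult_left continuous_on_exp indefinite_integral_continuous_1
        integrable_continuous_real)
  then show "continuous_on {a..b} (\<lambda>t. Fbound P Q R a t c1 c)"
    by (rule continuous_on_eq) (auto simp: Fbound_eq[OF P Q R pos])
qed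

text \<open>Along a solution the equation is linear; its Riccati variable \<open>v / x\<close> stays below the
  solution of the linear equation obtained by dropping the quadratic term.\<close>

lemma linear_system_estimate:
  fixes x v p \<kappa> r P Q R :: "real \<Rightarrow> real"
  assumes x: "\<And>t. t \<in> {a..b} \<Longrightarrow> (x has_real_derivative v t / p t) (at t within {a..b})"
    and v: "\<And>t. t \<in> {a..b} \<Longrightarrow> (v has_real_derivative - \<kappa> t * v t - r t * x t) (at t within {a..b})"
    and \<kappa>: "continuous_on {a..b} \<kappa>"
    and coeffs: "\<And>t. t \<in> {a..b} \<Longrightarrow> P t \<le> p t \<and> Q t \<le> \<kappa> t \<and> R t \<le> r t \<and> r t \<le> 0"
    and P: "continuous_on {a..} P" and Q: "continuous_on {a..} Q" and R: "continuous_on {a..} R"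
    and P_pos: "\<And>t. t \<ge> a \<Longrightarrow> P t > 0"
    and "x a > 0" "v a \<ge> 0" "a \<le> b"
  shows "s \<in> {a..b} \<Longrightarrow> 0 < x s \<and> x s \<le> x b" and "v b \<ge> 0" and "v a > 0 \<Longrightarrow> v b > 0"
    and "v b \<le> x b * riccati_bound Q R a (v a / x a) b"
    and "x b \<le> Fbound P Q R a b (x a) (v a / x a)"
proof -
  define V where "V = riccati_bound Q R a (v a / x a)"
  let ?K = "\<lambda>t. integral {a..t} \<kappa>"
  have p_pos: "p t > 0" if "t \<in> {a..b}" for t
    using coeffs[OF that] P_pos[of t] that by auto
  have cx: "continuous_on {a..b} x"
    using x by (rule DERIV_continuous_on)
  have K: "(?K has_real_derivative \<kappa> t) (at t within {a..b})" if "t \<in> {a..b}" for t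
    using \<kappa> that by (rule integral_has_real_derivative)
  \<comment> \<open>The integrating factor removes the damping term; what remains is nonnegative
    wherever \<open>x\<close> is, because \<open>r\<close> is nonpositive.\<close>
  have vE_deriv: "((\<lambda>t. v t * exp (?K t)) has_real_derivative - r t * x t * exp (?K t)) (at t within {a..b})"
    if t: "t \<in> {a..b}" for t
    by (rule derivative_eq_intros v[OF t] K[OF t] refl | simp)+ (simp add: algebra_simps)
  \<comment> \<open>Positivity of \<open>x\<close> is assumed only strictly between \<open>a\<close>
    and \<open>t\<close>, so that this and the next two facts apply with \<open>t\<close> the first
    point where \<open>x\<close> fails to be positive.\<close>
  have v_mono: "v a \<le> v t * exp (?K t)" if t: "a \<le> t" "t \<le> b" and pos: "\<And>s. a < s \<Longrightarrow> s < t \<Longrightarrow> x s > 0" for t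
  proof -
    have "v a * exp (?K a) \<le> v t * exp (?K t)"
    proof (rule nondecreasing_if_deriv_nonneg[where f = "\<lambda>t. v t * exp (?K t)" and a = a and b = t])
      show "((\<lambda>t. v t * exp (?K t)) has_real_derivative - r s * x s * exp (?K s)) (at s within {a..t})"
        if "s \<in> {a..t}" for s
        by (rule DERIV_subset[OF vE_deriv]) (use that t in auto)
      show "- r s * x s * exp (?K s) \<ge> 0" if "s \<in> {a<..<t}" for s
        using that t coeffs[of s] pos[of s] by (simp add: mult_nonpos_nonneg)
    qed (use t in auto)
    then show ?thesis
      by simp
  qed
  have v_nonneg: "v t \<ge> 0" if "a \<le> t" "t \<le> b" "\<And>s. a < s \<Longrightarrow> s < t \<Longrightarrow> x s > 0" for t
  proof -
    have "0 \<le> v t * exp (?K t)"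
      using v_mono[OF that] \<open>v a \<ge> 0\<close> by simp
    then show ?thesis
      by (simp add: zero_le_mult_iff)
  qed
  have x_ge: "x a \<le> x t" if t: "a \<le> t" "t \<le> b" and pos: "\<And>s. a < s \<Longrightarrow> s < t \<Longrightarrow> x s > 0" for t
  proof (rule nondecreasing_if_deriv_nonneg[where f = x and a = a and b = t])
    show "(x has_real_derivative v s / p s) (at s within {a..t})" if "s \<in> {a..t}" for s
      by (rule DERIV_subset[OF x]) (use that t in auto)
    show "v s / p s \<ge> 0" if "s \<in> {a<..<t}" for s
      using v_nonneg[of s] p_pos[of s] pos that t by (simp add: less_imp_le)
  qed (use t in auto)
  have x_pos: "x t > 0" if t: "t \<in> {a..b}" for t
  proof (rule ccontr)
    assume "\<not> x t > 0"
    \<comment> \<open>\<open>Inf S\<close> is the first point where \<open>x\<close> is not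
      positive. Up to it \<open>x\<close> is nondecreasing, so its value there is at least
      \<open>x a\<close>, a contradiction.\<close>
    define S where "S = {s \<in> {a..b}. x s \<le> 0}"
    have "closed S"
      unfolding S_def using cx by (intro continuous_on_closed_Collect_le) auto
    moreover have "t \<in> S" "bdd_below S"
      using t \<open>\<not> x t > 0\<close> by (auto simp: S_def bdd_below_def)
    ultimately have inf: "Inf S \<in> S"
      using closed_contains_Inf[of S] by blast
    have "x s > 0" if "a < s" "s < Inf S" for s
    proof (rule ccontr)
      assume "\<not> x s > 0"
      then have "s \<in> S"
        using that inf by (auto simp: S_def)
      then show False
        using cInf_lower[OF _ \<open>bdd_below S\<close>] that by fastforce
    qed
    then have "x a \<le> x (Inf S)"
      using inf by (intro x_ge) (auto simp: S_def)
    then show False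
      using inf \<open>x a > 0\<close> by (simp add: S_def)
  qed
  have v0: "v t \<ge> 0" if "t \<in> {a..b}" for t
    using v_nonneg[of t] x_pos that by simp
  show "0 < x s \<and> x s \<le> x b" if s: "s \<in> {a..b}"
  proof
    show "x s \<le> x b"
    proof (rule nondecreasing_if_deriv_nonneg[where f = x and a = a and b = b])
      show "v t / p t \<ge> 0" if "t \<in> {a<..<b}" for t
        using v0[of t] p_pos[of t] that by (simp add: less_imp_le)
    qed (use x s in auto)
  qed (rule x_pos[OF s])
  show "v b \<ge> 0"
    using v0 \<open>a \<le> b\<close> by simp
  show "v b > 0" if "v a > 0"
  proof -
    have "0 < v b * exp (?K b)"
      using v_mono[of b] x_pos \<open>a \<le> b\<close> that by simp
    then show ?thesis
      by (simp add: zero_less_mult_iff)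
  qed
  let ?y = "\<lambda>t. v t / x t"
  have y: "(?y has_real_derivative - \<kappa> t * ?y t - r t - (?y t)\<^sup>2 / p t) (at t within {a..b})"
    if t: "t \<in> {a..b}" for t
    using x_pos[OF t] p_pos[OF t]
    by (auto intro!: derivative_eq_intros x[OF t] v[OF t] simp: field_simps power2_eq_square)
  have A: "((\<lambda>t. integral {a..t} Q) has_real_derivative Q t) (at t within {a..b})" if "t \<in> {a..b}" for t
    using Q that by (rule integral_deriv_atLeast)
  let ?E = "\<lambda>t. exp (integral {a..t} Q)"
  have V: "(V has_real_derivative - Q t * V t - R t) (at t within {a..b})" if "t \<in> {a..b}" for t
    unfolding V_def using Q R that by (rule riccati_bound_deriv)
  have y_le: "?y t \<le> V t" if t: "t \<in> {a..b}" for t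
  proof -
    \<comment> \<open>Subtracting the Riccati equation of \<open>v / x\<close> from the linear
      equation of \<open>V\<close> leaves, after the integrating factor \<open>?E\<close>, the terms
      \<open>r - R\<close>, \<open>(\<kappa> - Q) * y\<close> and \<open>y^2 / p\<close>. All are
      nonnegative, the middle one because \<open>y\<close> is; and \<open>V\<close> and
      \<open>y\<close> agree at \<open>a\<close>.\<close>
    have "(V a - ?y a) * ?E a \<le> (V t - ?y t) * ?E t"
    proof (rule nondecreasing_if_deriv_nonneg[where f = "\<lambda>t. (V t - ?y t) * ?E t" and a = a and b = b])
      fix s assume s: "s \<in> {a..b}"
      show "((\<lambda>t. (V t - ?y t) * ?E t) has_real_derivative
          ((r s - R s) + (\<kappa> s - Q s) * ?y s + (?y s)\<^sup>2 / p s) * ?E s) (at s within {a..b})"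
        by (rule V[OF s] y[OF s] A[OF s] derivative_eq_intros refl)+
          (simp add: algebra_simps diff_divide_distrib)
    next
      fix s assume "s \<in> {a<..<b}"
      then have s: "s \<in> {a..b}"
        by auto
      show "((r s - R s) + (\<kappa> s - Q s) * ?y s + (?y s)\<^sup>2 / p s) * ?E s \<ge> 0"
        using coeffs[OF s] v0[OF s] x_pos[OF s] p_pos[OF s]
        by (intro mult_nonneg_nonneg add_nonneg_nonneg) auto
    qed (use t in auto)
    moreover have "V a = ?y a"
      by (simp add: V_def riccati_bound_def Iminus_def)
    ultimately show ?thesis
      by (simp add: zero_le_mult_iff)
  qed
  show "v b \<le> x b * riccati_bound Q R a (v a / x a) b"
    using y_le[of b] x_pos[of b] \<open>a \<le> b\<close> by (simp add: V_def field_simps)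
  let ?L = "\<lambda>t. integral {a..t} (\<lambda>\<tau>. V \<tau> / P \<tau>)"
  have "continuous_on {a..b} (\<lambda>\<tau>. V \<tau> / P \<tau>)"
    using P_pos by (intro continuous_on_divide DERIV_continuous_on[OF V] continuous_on_subset[OF P])
      force+
  then have L: "(?L has_real_derivative V t / P t) (at t within {a..b})" if "t \<in> {a..b}" for t
    using that by (rule integral_has_real_derivative)
  \<comment> \<open>The derivative of \<open>ln x\<close> is \<open>y / p\<close>, which is at most
    \<open>V / P\<close>: the numerator grows, the denominator shrinks, and \<open>y\<close> is
    nonnegative.\<close>
  have "?L a - ln (x a) \<le> ?L b - ln (x b)"
  proof (rule nondecreasing_if_deriv_nonneg[where f = "\<lambda>t. ?L t - ln (x t)" and a = a and b = b])
    fix s assume s: "s \<in> {a..b}"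
    show "((\<lambda>t. ?L t - ln (x t)) has_real_derivative V s / P s - ?y s / p s) (at s within {a..b})"
      by (rule L[OF s] x[OF s] x_pos[OF s] derivative_eq_intros refl)+ (simp add: field_simps)
  next
    fix s assume "s \<in> {a<..<b}"
    then have s: "s \<in> {a..b}"
      by auto
    have "?y s / p s \<le> V s / P s"
      using y_le[OF s] coeffs[OF s] P_pos[of s] s v0[OF s] x_pos[OF s]
      by (intro frac_le) (auto intro: order_trans[OF divide_nonneg_pos])
    then show "V s / P s - ?y s / p s \<ge> 0"
      by simp
  qed (use \<open>a \<le> b\<close> in auto)
  then have "ln (x b) \<le> ln (x a) + ?L b"
    by simp
  then have "exp (ln (x b)) \<le> exp (ln (x a) + ?L b)"
    by simp
  then have "x b \<le> x a * exp (?L b)"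
    using x_pos[of b] x_pos[of a] \<open>a \<le> b\<close> by (simp add: exp_add)
  then show "x b \<le> Fbound P Q R a b (x a) (v a / x a)"
    using \<open>x a > 0\<close> \<open>a \<le> b\<close> by (simp add: Fbound_eq[OF P Q R P_pos] V_def)
qed

subsection \<open>Extension of solutions\<close>

text \<open>Away from \<open>b\<close> only one of the two functions matters; at \<open>b\<close>
  both one-sided derivatives equal \<open>D\<close>.\<close>

lemma has_vector_derivative_glue:
  assumes "a \<le> b" "a \<le> t"
    and "t \<le> b \<Longrightarrow> (f has_vector_derivative D) (at t within {a..b})"
    and "b \<le> t \<Longrightarrow> (g has_vector_derivative D) (at t within {b..})"
    and "f b = g b"
  shows "((\<lambda>t. if t \<le> b then f t else g t) has_vector_derivative D) (at t within {a..})"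
proof -
  have "((\<lambda>t. if t \<in> {a..b} then f t else g t) has_vector_derivative
      (if t \<in> {a..b} then D else D)) (at t within {a..})"
  proof (rule has_vector_derivative_If_within_closures[where T = "{b..}"])
    have "{a..b} \<union> (closure {a..b} \<inter> closure {b..}) = {a..b}"
      "{b..} \<union> (closure {a..b} \<inter> closure {b..}) = {b..}"
      using \<open>a \<le> b\<close> by auto
    note closures = this
    show "(f has_vector_derivative D) (at t within {a..b} \<union> (closure {a..b} \<inter> closure {b..}))"
      if "t \<in> {a..b} \<union> (closure {a..b} \<inter> closure {b..})"
      using that assms unfolding closures by auto
    show "(g has_vector_derivative D) (at t within {b..} \<union> (closure {a..b} \<inter> closure {b..}))"
      if "t \<in> {b..} \<union> (closure {a..b} \<inter> closure {b..})"
      using that assms unfolding closures by auto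
    show "f t = g t" if "t \<in> closure {a..b}" "t \<in> closure {b..}"
      using that assms(5) by (cases "t = b") auto
  qed (use assms in auto)
  then have "((\<lambda>t. if t \<in> {a..b} then f t else g t) has_vector_derivative D) (at t within {a..})"
    by simp
  then show ?thesis
    unfolding has_vector_derivative_def
    by (rule has_derivative_transform[rotated 2]) (use assms in auto)
qed

text \<open>The interior derivative and continuity give \<open>g\<close> as \<open>g a\<close> plus
  the integral of \<open>k\<close>, and such an integral with continuous integrand is differentiable
  at the endpoints too.\<close>

lemma has_vector_derivative_closed_endpoint:
  fixes g :: "real \<Rightarrow> 'a::banach"
  assumes g: "continuous_on {a..b} g" and k: "continuous_on {a..b} k"
    and deriv: "\<And>t. t \<in> {a<..<b} \<Longrightarrow> (g has_vector_derivative k t) (at t)"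
    and t: "t \<in> {a..b}"
  shows "(g has_vector_derivative k t) (at t within {a..b})"
proof -
  have eq: "g s = g a + integral {a..s} k" if s: "s \<in> {a..b}" for s
  proof -
    have "(k has_integral (g s - g a)) {a..s}"
      using s by (intro fundamental_theorem_of_calculus_interior deriv continuous_on_subset[OF g]) auto
    then show ?thesis
      by (simp add: integral_unique)
  qed
  have "((\<lambda>s. g a + integral {a..s} k) has_vector_derivative k t) (at t within {a..b})"
    using integral_has_vector_derivative[OF k t] by (auto intro!: derivative_eq_intros)
  then show ?thesis
    unfolding has_vector_derivative_def
    by (rule has_derivative_transform[OF t eq, rotated])
qed

text \<open>The first-order form of the equation, for the pair of \<open>\<phi>\<close> and \<open>p0(t; \<phi>) \<phi>'\<close>.\<close>

definition field ::
  "(real \<Rightarrow> real \<Rightarrow> real) \<Rightarrow> (real \<Rightarrow> real \<Rightarrow> real) \<Rightarrow> (real \<Rightarrow> real \<Rightarrow> real) \<Rightarrow>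
   real \<Rightarrow> real \<times> real \<Rightarrow> real \<times> real" where
  "field p q r t z = (snd z / p t (fst z),
     - (q t (fst z) / p t (fst z)) * snd z - r t (fst z) * fst z)"

definition system_on ::
  "(real \<Rightarrow> real \<Rightarrow> real) \<Rightarrow> (real \<Rightarrow> real \<Rightarrow> real) \<Rightarrow> (real \<Rightarrow> real \<Rightarrow> real) \<Rightarrow>
   real set \<Rightarrow> (real \<Rightarrow> real \<times> real) \<Rightarrow> bool" where
  "system_on p q r J Y \<longleftrightarrow> (\<forall>t\<in>J. (Y has_vector_derivative field p q r t (Y t)) (at t within J))"

lemma system_on_fst_snd:
  assumes "system_on p q r J Y" "t \<in> J"
  shows "((\<lambda>t. fst (Y t)) has_real_derivative snd (Y t) / p t (fst (Y t))) (at t within J)"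
    and "((\<lambda>t. snd (Y t)) has_real_derivative
      - (q t (fst (Y t)) / p t (fst (Y t))) * snd (Y t) - r t (fst (Y t)) * fst (Y t)) (at t within J)"
proof -
  have Y: "(Y has_vector_derivative field p q r t (Y t)) (at t within J)"
    using assms by (simp add: system_on_def)
  from bounded_linear.has_vector_derivative[OF bounded_linear_fst Y]
  show "((\<lambda>t. fst (Y t)) has_real_derivative snd (Y t) / p t (fst (Y t))) (at t within J)"
    by (simp add: field_def has_real_derivative_iff_has_vector_derivative)
  from bounded_linear.has_vector_derivative[OF bounded_linear_snd Y]
  show "((\<lambda>t. snd (Y t)) has_real_derivative
      - (q t (fst (Y t)) / p t (fst (Y t))) * snd (Y t) - r t (fst (Y t)) * fst (Y t)) (at t within J)"
    by (simp add: field_def has_real_derivative_iff_has_vector_derivative)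
qed

lemma system_on_subset: "system_on p q r J Y \<Longrightarrow> I \<subseteq> J \<Longrightarrow> system_on p q r I Y"
  unfolding system_on_def by (blast intro: has_vector_derivative_within_subset)

lemma continuous_on_system: "system_on p q r J Y \<Longrightarrow> continuous_on J Y"
  unfolding system_on_def continuous_on_eq_continuous_within
  by (blast intro: has_vector_derivative_continuous)

text \<open>Agreement along the curve suffices, which is what lets clamped coefficients replace the
  original ones.\<close>

lemma system_on_cong:
  assumes "\<And>t. t \<in> J \<Longrightarrow> p t (fst (Y t)) = p' t (fst (Y t)) \<and> q t (fst (Y t)) = q' t (fst (Y t)) \<and>
    r t (fst (Y t)) = r' t (fst (Y t))"
  shows "system_on p q r J Y \<longleftrightarrow> system_on p' q' r' J Y"
  using assms by (simp add: system_on_def field_def)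

lemma continuous_on_curried:
  assumes "continuous_on (A \<times> UNIV) (\<lambda>(t, w). k t w)" "continuous_on S \<phi>" "continuous_on S \<tau>" "\<tau> ` S \<subseteq> A"
  shows "continuous_on S (\<lambda>s. k (\<tau> s) (\<phi> s))"
  using continuous_on_compose2[OF assms(1), of S "\<lambda>s. (\<tau> s, \<phi> s)"] assms(2-4)
  by (auto intro: continuous_on_Pair)

lemma continuous_on_field:
  assumes "continuous_on (A \<times> UNIV) (\<lambda>(t, w). p t w)" "continuous_on (A \<times> UNIV) (\<lambda>(t, w). q t w)"
    "continuous_on (A \<times> UNIV) (\<lambda>(t, w). r t w)" and pos: "\<And>t w. t \<in> A \<Longrightarrow> p t w > 0"
  shows "continuous_on (A \<times> UNIV) (\<lambda>(t, z). field p q r t z)"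
proof -
  have *: "continuous_on (A \<times> UNIV) (\<lambda>x. k (fst x) (fst (snd x)))"
    if "continuous_on (A \<times> UNIV) (\<lambda>(t, w). k t w)" for k :: "real \<Rightarrow> real \<Rightarrow> real"
    using that by (rule continuous_on_curried) (auto intro!: continuous_intros)
  have "continuous_on (A \<times> UNIV) (\<lambda>x. field p q r (fst x) (snd x))"
    unfolding field_def
    using assms by (intro continuous_intros * ballI) (auto dest!: pos[THEN less_imp_neq, symmetric])
  then show ?thesis
    by (simp add: case_prod_beta')
qed

lemma system_on_if_solution_on:
  assumes "solution_on p q r J \<phi> \<phi>'" and pos: "\<And>t w. t \<in> J \<Longrightarrow> p t w > 0"
  shows "system_on p q r J (\<lambda>t. (\<phi> t, p t (\<phi> t) * \<phi>' t))"
proof -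
  obtain \<psi> where \<psi>: "\<And>t. t \<in> J \<Longrightarrow> ((\<lambda>s. p s (\<phi> s) * \<phi>' s) has_real_derivative \<psi> t) (at t within J)"
    "\<And>t. t \<in> J \<Longrightarrow> \<psi> t + q t (\<phi> t) * \<phi>' t + r t (\<phi> t) * \<phi> t = 0"
    and \<phi>: "\<And>t. t \<in> J \<Longrightarrow> (\<phi> has_real_derivative \<phi>' t) (at t within J)"
    using assms(1) unfolding solution_on_def by blast
  show ?thesis
    unfolding system_on_def
  proof
    fix t assume t: "t \<in> J"
    have "field p q r t (\<phi> t, p t (\<phi> t) * \<phi>' t) = (\<phi>' t, \<psi> t)"
      using \<psi>(2)[OF t] pos[OF t, of "\<phi> t"] by (simp add: field_def)
    then show "((\<lambda>t. (\<phi> t, p t (\<phi> t) * \<phi>' t)) has_vector_derivative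
        field p q r t (\<phi> t, p t (\<phi> t) * \<phi>' t)) (at t within J)"
      using has_vector_derivative_Pair[of \<phi> "\<phi>' t" t J "\<lambda>s. p s (\<phi> s) * \<phi>' s" "\<psi> t"] \<phi>[OF t] \<psi>(1)[OF t]
      by (simp add: has_real_derivative_iff_has_vector_derivative)
  qed
qed

lemma solution_on_if_system_on:
  assumes Y: "system_on p q r J Y"
    and cont: "continuous_on (J \<times> UNIV) (\<lambda>(t, w). p t w)" "continuous_on (J \<times> UNIV) (\<lambda>(t, w). q t w)"
      "continuous_on (J \<times> UNIV) (\<lambda>(t, w). r t w)"
    and pos: "\<And>t w. t \<in> J \<Longrightarrow> p t w > 0"
  shows "solution_on p q r J (\<lambda>t. fst (Y t)) (\<lambda>t. snd (Y t) / p t (fst (Y t)))"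
proof -
  have f: "continuous_on J (\<lambda>t. field p q r t (Y t))"
    by (rule continuous_on_curried[OF continuous_on_field[OF cont pos] continuous_on_system[OF Y]]) auto
  show ?thesis
    unfolding solution_on_def
  \<comment> \<open>The second component of the field is the derivative of
    \<open>p * \<phi>'\<close>; its continuity comes from that of the field and of
    \<open>Y\<close>.\<close>
  proof (intro conjI ballI exI[of _ "\<lambda>t. snd (field p q r t (Y t))"])
    show "continuous_on J (\<lambda>t. snd (Y t) / p t (fst (Y t)))"
      using continuous_on_fst[OF f] by (simp add: field_def)
    show "continuous_on J (\<lambda>t. snd (field p q r t (Y t)))"
      using f by (rule continuous_on_snd)
    fix t assume t: "t \<in> J"
    show "((\<lambda>t. fst (Y t)) has_real_derivative snd (Y t) / p t (fst (Y t))) (at t within J)"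
      using Y t by (rule system_on_fst_snd)
    show "((\<lambda>s. p s (fst (Y s)) * (snd (Y s) / p s (fst (Y s)))) has_real_derivative
        snd (field p q r t (Y t))) (at t within J)"
    proof (rule has_field_derivative_eq_on)
      show "((\<lambda>t. snd (Y t)) has_real_derivative snd (field p q r t (Y t))) (at t within J)"
        using system_on_fst_snd(2)[OF Y t] by (simp add: field_def)
    qed (use t in \<open>auto dest!: pos[THEN less_imp_neq, symmetric]\<close>)
    show "snd (field p q r t (Y t)) + q t (fst (Y t)) * (snd (Y t) / p t (fst (Y t))) +
        r t (fst (Y t)) * fst (Y t) = 0"
      by (simp add: field_def)
  qed
qed


lemma system_on_glue:
  assumes "system_on p q r {a..b} Y" "system_on p q r {b..} Z" "Y b = Z b" "a \<le> b"
  shows "system_on p q r {a..} (\<lambda>t. if t \<le> b then Y t else Z t)"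
  unfolding system_on_def
proof
  fix t assume t: "t \<in> {a..}"
  show "((\<lambda>t. if t \<le> b then Y t else Z t) has_vector_derivative
      field p q r t (if t \<le> b then Y t else Z t)) (at t within {a..})"
  proof (rule has_vector_derivative_glue[OF \<open>a \<le> b\<close>])
    show "(Y has_vector_derivative field p q r t (if t \<le> b then Y t else Z t)) (at t within {a..b})" if "t \<le> b"
      using assms(1) t that by (simp add: system_on_def)
    show "(Z has_vector_derivative field p q r t (if t \<le> b then Y t else Z t)) (at t within {b..})" if "b \<le> t"
      using assms(2,3) that by (cases "t = b") (auto simp: system_on_def)
  qed (use t assms in auto)
qed

text \<open>Bounded velocity makes \<open>Y\<close> Lipschitz, so it has a continuous extension to
  \<open>b\<close>; the differential equation then carries over to the endpoint by
  \<open>has_vector_derivative_closed_endpoint\<close>.\<close>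

lemma system_on_extend_closed:
  assumes Y: "system_on p q r {a..<b} Y" and "a < b"
    and f: "continuous_on ({a..} \<times> UNIV) (\<lambda>(t, z). field p q r t z)"
    and B: "\<And>t. t \<in> {a..<b} \<Longrightarrow> norm (field p q r t (Y t)) \<le> B"
  obtains Z where "system_on p q r {a..b} Z" "\<And>t. t \<in> {a..<b} \<Longrightarrow> Z t = Y t"
proof -
  have "B \<ge> 0"
    using order_trans[OF norm_ge_zero B[of a]] \<open>a < b\<close> by simp
  have "B-lipschitz_on {a..<b} Y"
  proof (rule bounded_derivative_imp_lipschitz)
    show "(Y has_derivative (\<lambda>h. h *\<^sub>R field p q r t (Y t))) (at t within {a..<b})" if "t \<in> {a..<b}" for t
      using Y that by (simp add: system_on_def has_vector_derivative_def)
    show "onorm (\<lambda>h. h *\<^sub>R field p q r t (Y t)) \<le> B" if "t \<in> {a..<b}" for t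
      using B[OF that] \<open>B \<ge> 0\<close> by (intro onorm_bound) (auto simp: mult.commute[of B] mult_left_mono)
  qed (use \<open>B \<ge> 0\<close> in auto)
  then obtain Z where Z: "B-lipschitz_on (closure {a..<b}) Z" "\<And>t. t \<in> {a..<b} \<Longrightarrow> Z t = Y t"
    using lipschitz_extend_closure by metis
  have cZ: "continuous_on {a..b} Z"
    using lipschitz_on_continuous_on[OF Z(1)] \<open>a < b\<close> by simp
  have "system_on p q r {a..b} Z"
    unfolding system_on_def
  proof
    fix t assume t: "t \<in> {a..b}"
    show "(Z has_vector_derivative field p q r t (Z t)) (at t within {a..b})"
    proof (rule has_vector_derivative_closed_endpoint[OF cZ _ _ t])
      show "continuous_on {a..b} (\<lambda>t. field p q r t (Z t))"
        by (rule continuous_on_curried[OF f cZ]) auto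
      fix s assume s: "s \<in> {a<..<b}"
      have "(Y has_vector_derivative field p q r s (Y s)) (at s within {a<..<b})"
        by (rule has_vector_derivative_within_subset[of Y _ s "{a..<b}"])
          (use Y s in \<open>auto simp: system_on_def\<close>)
      then have "(Y has_vector_derivative field p q r s (Z s)) (at s)"
        unfolding at_within_open[OF s open_greaterThanLessThan] using Z(2)[of s] s by simp
      then show "(Z has_vector_derivative field p q r s (Z s)) (at s)"
        by (rule has_vector_derivative_transform_within_open[OF _ open_greaterThanLessThan s])
          (simp add: Z(2))
    qed
  qed
  then show thesis
    using Z(2) that by blast
qed

lemma right_interval_cases:
  assumes "right_interval t0 J"
  obtains "J = {t0..}" | b where "t0 < b" "J = {t0..b}" | b where "t0 < b" "J = {t0..<b}"
proof -
  have conv: "s \<in> J" if "t \<in> J" "t0 \<le> s" "s \<le> t" for s t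
    using assms that unfolding right_interval_def is_interval_1 by blast
  have J: "t0 \<in> J" "J \<subseteq> {t0..}" "J \<noteq> {t0}"
    using assms by (auto simp: right_interval_def)
  show thesis
  proof (cases "bdd_above J")
    case True
    define b where "b = Sup J"
    have le: "t \<le> b" if "t \<in> J" for t
      unfolding b_def using that True by (rule cSup_upper)
    obtain t1 where "t1 \<in> J" "t1 \<noteq> t0"
      using J by blast
    then have "t0 < b"
      using le[of t1] J(2) by force
    have "t \<in> J" if "t0 \<le> t" "t < b" for t
      using less_cSupE[of t J] that conv J(1) unfolding b_def by (metis empty_iff less_imp_le)
    then have "{t0..<b} \<subseteq> J" "J \<subseteq> {t0..b}"
      using le J(2) by auto
    then have "J = {t0..b} \<or> J = {t0..<b}"
      by (cases "b \<in> J") (force simp: less_le)+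
    then show thesis
      using that(2,3) \<open>t0 < b\<close> by blast
  next
    case False
    have "t \<in> J" if "t0 \<le> t" for t
      using False conv that unfolding bdd_above_def by (meson le_cases)
    then show thesis
      using that(1) J(2) by auto
  qed
qed

lemma continuous_on_compact_abs_bounded:
  fixes f :: "'a::topological_space \<Rightarrow> real"
  assumes "compact S" "continuous_on S f"
  shows "\<exists>B\<ge>0. \<forall>x\<in>S. \<bar>f x\<bar> \<le> B"
proof -
  have "bounded (f ` S)"
    using assms by (intro compact_imp_bounded compact_continuous_image)
  then show ?thesis
    unfolding bounded_pos by (auto intro: less_imp_le)
qed

subsection \<open>The a priori estimate and global existence\<close>

locale riccati_majorant =
  fixes t0 a0 a1 \<epsilon> :: real
    and p0 q0 r0 :: "real \<Rightarrow> real \<Rightarrow> real"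
    and P Q R :: "real \<Rightarrow> real"
  assumes p0: "continuous_on ({t0..} \<times> UNIV) (\<lambda>(t, w). p0 t w)"
    and q0: "continuous_on ({t0..} \<times> UNIV) (\<lambda>(t, w). q0 t w)"
    and r0: "continuous_on ({t0..} \<times> UNIV) (\<lambda>(t, w). r0 t w)"
    and p0_pos: "\<And>t w. t \<ge> t0 \<Longrightarrow> p0 t w > 0"
    and P: "continuous_on {t0..} P" and Q: "continuous_on {t0..} Q" and R: "continuous_on {t0..} R"
    and P_pos: "\<And>t. t \<ge> t0 \<Longrightarrow> P t > 0"
    and a0: "a0 \<noteq> 0" and a1: "a1 / a0 \<ge> 0"
    and \<epsilon>: "\<epsilon> > 0"
    and coeffs: "\<And>t w. t \<ge> t0 \<Longrightarrow> \<bar>w\<bar> \<le> Fbound P Q R t0 t a0 (p0 t0 a0 * (a1 / a0)) + \<epsilon> \<Longrightarrow>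
           p0 t w \<ge> P t \<and> q0 t w / p0 t w \<ge> Q t \<and> R t \<le> r0 t w \<and> r0 t w \<le> 0"
begin

definition F :: "real \<Rightarrow> real" where
  "F t = Fbound P Q R t0 t a0 (p0 t0 a0 * (a1 / a0))"

definition V :: "real \<Rightarrow> real" where
  "V = riccati_bound Q R t0 (p0 t0 a0 * (a1 / a0))"

lemma F_nonneg: "F t \<ge> 0"
  by (simp add: F_def Fbound_def)

lemma continuous_F: "continuous_on {t0..} F"
  unfolding F_def using P Q R P_pos by (rule continuous_on_Fbound)

lemma continuous_V: "continuous_on {t0..b} V"
  unfolding V_def by (rule DERIV_continuous_on[OF riccati_bound_deriv[OF Q R]])

lemma F_bounded: "\<exists>C\<ge>0. \<forall>t\<in>{t0..b}. \<bar>F t\<bar> \<le> C"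
  by (intro continuous_on_compact_abs_bounded continuous_on_subset[OF continuous_F]) auto

lemma V_bounded: "\<exists>C\<ge>0. \<forall>t\<in>{t0..b}. \<bar>V t\<bar> \<le> C"
  by (intro continuous_on_compact_abs_bounded continuous_V) auto

definition coeffs_majorized where
  "coeffs_majorized p q r t w \<longleftrightarrow> P t \<le> p t w \<and> Q t \<le> q t w / p t w \<and> R t \<le> r t w \<and> r t w \<le> 0"

text \<open>Multiplication by the sign of \<open>a0\<close> reduces this to the positive case of
  \<open>linear_system_estimate\<close>. The coefficients are arbitrary and majorized only along the
  curve, so that both the original and the clamped system are covered.\<close>

lemma system_estimate:
  assumes Y: "system_on p q r {t0..T} Y" and Y0: "Y t0 = (a0, p0 t0 a0 * a1)" and "t0 \<le> T"
    and cont: "continuous_on ({t0..} \<times> UNIV) (\<lambda>(t, w). p t w)" "continuous_on ({t0..} \<times> UNIV) (\<lambda>(t, w). q t w)"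
    and maj: "\<And>t. t \<in> {t0..T} \<Longrightarrow> coeffs_majorized p q r t (fst (Y t))"
  shows "s \<in> {t0..T} \<Longrightarrow> 0 < \<bar>fst (Y s)\<bar> \<and> \<bar>fst (Y s)\<bar> \<le> \<bar>fst (Y T)\<bar>"
    and "\<bar>fst (Y T)\<bar> \<le> F T" and "\<bar>snd (Y T)\<bar> \<le> \<bar>fst (Y T)\<bar> * V T"
    and "a1 \<noteq> 0 \<Longrightarrow> snd (Y T) \<noteq> 0"
proof -
  define \<sigma> where "\<sigma> = sgn a0"
  let ?x = "\<lambda>t. \<sigma> * fst (Y t)" and ?v = "\<lambda>t. \<sigma> * snd (Y t)"
  have \<sigma>: "\<sigma> * a0 = \<bar>a0\<bar>" "\<bar>\<sigma>\<bar> = 1"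
    using a0 by (auto simp: \<sigma>_def sgn_mult_abs abs_sgn_eq mult.commute) (auto simp: sgn_if)
  have \<sigma>1: "\<sigma> * a1 = \<bar>a0\<bar> * (a1 / a0)"
    using a0 by (auto simp: \<sigma>_def sgn_if)
  have c: "?v t0 / ?x t0 = p0 t0 a0 * (a1 / a0)"
    using a0 by (simp add: Y0 \<sigma>_def sgn_zero_iff)
  have p_pos: "p t (fst (Y t)) > 0" if "t \<in> {t0..T}" for t
    using maj[OF that] P_pos[of t] that by (auto simp: coeffs_majorized_def)
  have cY: "continuous_on {t0..T} (\<lambda>t. fst (Y t))"
    using continuous_on_system[OF Y] by (rule continuous_on_fst)
  have x: "(?x has_real_derivative ?v t / p t (fst (Y t))) (at t within {t0..T})" if "t \<in> {t0..T}" for t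
    using DERIV_cmult[OF system_on_fst_snd(1)[OF Y that], of \<sigma>] by simp
  have v: "(?v has_real_derivative
      - (q t (fst (Y t)) / p t (fst (Y t))) * ?v t - r t (fst (Y t)) * ?x t) (at t within {t0..T})"
    if "t \<in> {t0..T}" for t
    using DERIV_cmult[OF system_on_fst_snd(2)[OF Y that], of \<sigma>] by (simp add: algebra_simps)
  have \<kappa>: "continuous_on {t0..T} (\<lambda>t. q t (fst (Y t)) / p t (fst (Y t)))"
    using p_pos by (intro continuous_on_divide continuous_on_curried[OF cont(1) cY]
        continuous_on_curried[OF cont(2) cY]) force+
  have x0: "?x t0 > 0"
    using a0 by (simp add: Y0 \<sigma>)
  have "?v t0 = p0 t0 a0 * (\<bar>a0\<bar> * (a1 / a0))"
    unfolding \<sigma>1[symmetric] by (simp add: Y0)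
  then have v0: "?v t0 \<ge> 0"
    using a1 p0_pos[of t0 a0] by (simp only:) (intro mult_nonneg_nonneg; simp)
  note est = linear_system_estimate[where p = "\<lambda>t. p t (fst (Y t))" and r = "\<lambda>t. r t (fst (Y t))",
      OF x v \<kappa> maj[unfolded coeffs_majorized_def] P Q R P_pos x0 v0 \<open>t0 \<le> T\<close>]
  have abs_x: "\<bar>fst (Y t)\<bar> = \<bar>?x t\<bar>" and abs_v: "\<bar>snd (Y t)\<bar> = \<bar>?v t\<bar>" for t
    by (simp_all add: abs_mult \<sigma>(2))
  have xs: "0 < ?x s \<and> ?x s \<le> ?x T" if "s \<in> {t0..T}" for s
    using est(1) that by blast
  show "0 < \<bar>fst (Y s)\<bar> \<and> \<bar>fst (Y s)\<bar> \<le> \<bar>fst (Y T)\<bar>" if "s \<in> {t0..T}"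
    using xs[OF that] unfolding abs_x by auto
  have xT: "\<bar>?x T\<bar> = ?x T"
    using xs[of T] \<open>t0 \<le> T\<close> by simp
  show "\<bar>fst (Y T)\<bar> \<le> F T"
    using est(5) unfolding abs_x xT c by (simp add: F_def Fbound_def Y0 \<sigma>)
  show "\<bar>snd (Y T)\<bar> \<le> \<bar>fst (Y T)\<bar> * V T"
    using est(4) est(2) unfolding abs_x abs_v xT c V_def by simp
  show "snd (Y T) \<noteq> 0" if "a1 \<noteq> 0"
  proof -
    have "?v t0 > 0"
      using that v0 p0_pos[of t0 a0] \<sigma>(2) by (auto simp: Y0 less_le)
    then show ?thesis
      using est(3) by auto
  qed
qed

text \<open>Initially \<open>F\<close> equals \<open>\<bar>a0\<bar>\<close>, so the bound holds with
  room to spare. At the first time \<open>b\<close> where the solution reaches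
  \<open>F + \<epsilon>\<close>, the coefficient inequalities are valid up to and including
  \<open>b\<close>, and the estimate gives the stronger bound \<open>F b\<close>, a
  contradiction.\<close>

lemma system_bootstrap:
  assumes Y: "system_on p0 q0 r0 {t0..T} Y" and Y0: "Y t0 = (a0, p0 t0 a0 * a1)" and t: "t \<in> {t0..T}"
  shows "\<bar>fst (Y t)\<bar> \<le> F t + \<epsilon>"
proof (rule ccontr)
  assume contra: "\<not> \<bar>fst (Y t)\<bar> \<le> F t + \<epsilon>"
  define S where "S = {s \<in> {t0..T}. F s + \<epsilon> \<le> \<bar>fst (Y s)\<bar>}"
  have "closed S"
    unfolding S_def using continuous_on_system[OF Y]
    by (intro continuous_on_closed_Collect_le continuous_intros continuous_on_subset[OF continuous_F]) auto
  moreover have "t \<in> S" "bdd_below S"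
    using t contra by (auto simp: S_def bdd_below_def)
  ultimately have inf: "Inf S \<in> S"
    using closed_contains_Inf[of S] by blast
  define b where "b = Inf S"
  have b: "b \<in> {t0..T}" "F b + \<epsilon> \<le> \<bar>fst (Y b)\<bar>"
    using inf by (auto simp: S_def b_def)
  have less: "\<bar>fst (Y s)\<bar> \<le> F s + \<epsilon>" if "s \<in> {t0..<b}" for s
  proof (rule ccontr)
    assume "\<not> \<bar>fst (Y s)\<bar> \<le> F s + \<epsilon>"
    then have "s \<in> S"
      using that b by (auto simp: S_def)
    then show False
      using cInf_lower[OF _ \<open>bdd_below S\<close>] that by (fastforce simp: b_def)
  qed
  have "t0 < b"
  proof (rule ccontr)
    assume "\<not> t0 < b"
    then have "b = t0"
      using b by auto
    then show False
      using b(2) \<epsilon> by (simp add: Y0 F_def Fbound_eq[OF P Q R P_pos])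
  qed
  have Yb: "system_on p0 q0 r0 {t0..b} Y"
    using Y by (rule system_on_subset) (use b in auto)
  \<comment> \<open>The choice of \<open>b\<close> gives only the opposite inequality at
    \<open>b\<close> itself; the required one follows from the times before \<open>b\<close> by
    continuity.\<close>
  have "closed {s \<in> {t0..b}. \<bar>fst (Y s)\<bar> \<le> F s + \<epsilon>}"
    using continuous_on_system[OF Yb]
    by (intro continuous_on_closed_Collect_le continuous_intros continuous_on_subset[OF continuous_F]) auto
  then have "closure {t0..<b} \<subseteq> {s \<in> {t0..b}. \<bar>fst (Y s)\<bar> \<le> F s + \<epsilon>}"
    by (intro closure_minimal) (use less in auto)
  then have le: "\<bar>fst (Y s)\<bar> \<le> F s + \<epsilon>" if "s \<in> {t0..b}" for s
    using that \<open>t0 < b\<close> by auto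
  have "\<bar>fst (Y b)\<bar> \<le> F b"
    using Yb Y0 less_imp_le[OF \<open>t0 < b\<close>] p0 q0
  proof (rule system_estimate(2))
    show "coeffs_majorized p0 q0 r0 s (fst (Y s))" if "s \<in> {t0..b}" for s
      using coeffs[of s "fst (Y s)"] le[OF that] that by (simp add: coeffs_majorized_def F_def)
  qed
  then show False
    using b \<epsilon> by simp
qed

section \<open>The system with clamped coefficients\<close>

definition clamp :: "real \<Rightarrow> real \<Rightarrow> real" where
  "clamp t w = max (- (F t + \<epsilon>)) (min (F t + \<epsilon>) w)"

definition clamped :: "(real \<Rightarrow> real \<Rightarrow> real) \<Rightarrow> real \<Rightarrow> real \<Rightarrow> real" where
  "clamped k t w = k t (clamp t w)"

lemma abs_clamp: "\<bar>clamp t w\<bar> \<le> F t + \<epsilon>"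
  using F_nonneg[of t] \<epsilon> by (auto simp: clamp_def)

lemma clamped_eq: "\<bar>w\<bar> \<le> F t + \<epsilon> \<Longrightarrow> clamped k t w = k t w"
  by (auto simp: clamped_def clamp_def abs_le_iff min_absorb2 max_absorb2)

lemma continuous_clamped:
  assumes "continuous_on ({t0..} \<times> UNIV) (\<lambda>(t, w). k t w)"
  shows "continuous_on ({t0..} \<times> UNIV) (\<lambda>(t, w). clamped k t w)"
proof -
  have "continuous_on ({t0..} \<times> UNIV) (\<lambda>x. F (fst x))"
    by (rule continuous_on_compose2[OF continuous_F]) (auto intro!: continuous_intros)
  then have "continuous_on ({t0..} \<times> UNIV) (\<lambda>x. clamp (fst x) (snd x))"
    unfolding clamp_def by (intro continuous_intros)
  then have "continuous_on ({t0..} \<times> UNIV) (\<lambda>x. clamped k (fst x) (snd x))"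
    unfolding clamped_def
    by (rule continuous_on_curried[OF assms]) (auto intro!: continuous_intros)
  then show ?thesis
    by (simp add: case_prod_beta')
qed

text \<open>\<open>F\<close> is bounded on a compact time interval, so there \<open>k\<close> is
  evaluated only on a compact rectangle.\<close>

lemma clamped_bounded:
  assumes "continuous_on ({t0..} \<times> UNIV) (\<lambda>(t, w). k t w)"
  shows "\<exists>B\<ge>0. \<forall>t\<in>{t0..b}. \<forall>w. \<bar>clamped k t w\<bar> \<le> B"
proof -
  obtain C where C: "\<And>t. t \<in> {t0..b} \<Longrightarrow> \<bar>F t\<bar> \<le> C"
    using F_bounded[of b] by blast
  have "continuous_on ({t0..b} \<times> {- (C + \<epsilon>)..C + \<epsilon>}) (\<lambda>(t, w). k t w)"
    by (rule continuous_on_subset[OF assms]) auto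
  then obtain B where B: "B \<ge> 0"
    "\<And>x. x \<in> {t0..b} \<times> {- (C + \<epsilon>)..C + \<epsilon>} \<Longrightarrow> \<bar>case x of (t, w) \<Rightarrow> k t w\<bar> \<le> B"
    using continuous_on_compact_abs_bounded[OF compact_Times[OF compact_Icc compact_Icc]] by blast
  have "\<bar>clamped k t w\<bar> \<le> B" if t: "t \<in> {t0..b}" for t w
  proof -
    have "\<bar>clamp t w\<bar> \<le> C + \<epsilon>"
      using abs_clamp[of t w] C[OF t] by linarith
    then show ?thesis
      unfolding clamped_def using t B(2)[of "(t, clamp t w)"] by (simp add: abs_le_iff)
  qed
  then show ?thesis
    using B(1) by (intro exI[of _ B]) auto
qed

abbreviation "clamped_field \<equiv> field (clamped p0) (clamped q0) (clamped r0)"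
abbreviation "clamped_system \<equiv> system_on (clamped p0) (clamped q0) (clamped r0)"

lemma clamped_p0_pos: "t \<ge> t0 \<Longrightarrow> clamped p0 t w > 0"
  by (simp add: clamped_def p0_pos)

lemma clamped_majorized: "t \<ge> t0 \<Longrightarrow> coeffs_majorized (clamped p0) (clamped q0) (clamped r0) t w"
  using coeffs[of t "clamp t w"] abs_clamp[of t w]
  by (simp add: clamped_def coeffs_majorized_def F_def)

lemma continuous_clamped_field: "continuous_on ({t0..} \<times> UNIV) (\<lambda>(t, z). clamped_field t z)"
  using p0 q0 r0 clamped_p0_pos by (intro continuous_on_field continuous_clamped) auto

text \<open>The field is linear in the state with coefficients \<open>1 / p0\<close>,
  \<open>q0 / p0\<close> and \<open>r0\<close> taken at the clamped argument, and these are bounded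
  on compact time intervals.\<close>

lemma clamped_field_growth: "\<exists>M\<ge>0. \<forall>t\<in>{t0..b}. \<forall>z. norm (clamped_field t z) \<le> M * (1 + norm z)"
proof -
  have nz: "p0 t w \<noteq> 0" if "t \<ge> t0" for t w
    using p0_pos[OF that, of w] by simp
  have "continuous_on ({t0..} \<times> UNIV) (\<lambda>(t, w). 1 / p0 t w)"
    "continuous_on ({t0..} \<times> UNIV) (\<lambda>(t, w). q0 t w / p0 t w)"
    using p0 q0 nz unfolding case_prod_beta' by (auto intro!: continuous_intros)
  then obtain B1 B2 B3 where B: "B1 \<ge> 0" "B2 \<ge> 0" "B3 \<ge> 0"
    "\<And>t w. t \<in> {t0..b} \<Longrightarrow> \<bar>clamped (\<lambda>t w. 1 / p0 t w) t w\<bar> \<le> B1"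
    "\<And>t w. t \<in> {t0..b} \<Longrightarrow> \<bar>clamped (\<lambda>t w. q0 t w / p0 t w) t w\<bar> \<le> B2"
    "\<And>t w. t \<in> {t0..b} \<Longrightarrow> \<bar>clamped r0 t w\<bar> \<le> B3"
    using clamped_bounded[of "\<lambda>t w. 1 / p0 t w" b] clamped_bounded[of "\<lambda>t w. q0 t w / p0 t w" b]
      clamped_bounded[OF r0, of b] by auto
  have "norm (clamped_field t z) \<le> (B1 + B2 + B3) * (1 + norm z)" if t: "t \<in> {t0..b}" for t z
  proof -
    obtain x u where z: "z = (x, u)"
      by force
    have xu: "\<bar>x\<bar> \<le> 1 + norm z" "\<bar>u\<bar> \<le> 1 + norm z"
      using norm_fst_le[of x u] norm_snd_le[of u x] by (auto simp: z)
    have "\<bar>u / clamped p0 t x\<bar> \<le> B1 * (1 + norm z)"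
      using mult_mono[OF B(4)[OF t, of x] xu(2)] B(1) by (simp add: clamped_def abs_mult)
    moreover have "\<bar>- (clamped q0 t x / clamped p0 t x) * u\<bar> \<le> B2 * (1 + norm z)"
      using mult_mono[OF B(5)[OF t, of x] xu(2)] B(2) by (simp add: clamped_def abs_mult)
    moreover have "\<bar>clamped r0 t x * x\<bar> \<le> B3 * (1 + norm z)"
      using mult_mono[OF B(6)[OF t, of x] xu(1)] B(3) by (simp add: abs_mult)
    moreover have "norm (clamped_field t z) \<le> \<bar>u / clamped p0 t x\<bar> +
        \<bar>- (clamped q0 t x / clamped p0 t x) * u - clamped r0 t x * x\<bar>"
      using norm_Pair_le[of "u / clamped p0 t x"
          "- (clamped q0 t x / clamped p0 t x) * u - clamped r0 t x * x"]
      by (simp add: field_def z)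
    ultimately show ?thesis
      unfolding distrib_right by linarith
  qed
  then show ?thesis
    using B by (intro exI[of _ "B1 + B2 + B3"]) auto
qed

lemma clamped_system_exists:
  assumes "t0 \<le> b"
  obtains Z where "Z b = z" "clamped_system {b..} Z"
proof (rule peano_linear_growth[of b clamped_field z])
  show "continuous_on ({b..} \<times> UNIV) (\<lambda>(t, z). clamped_field t z)"
    by (rule continuous_on_subset[OF continuous_clamped_field]) (use assms in auto)
  show "\<exists>M. \<forall>t\<in>{b..c}. \<forall>x. norm (clamped_field t x) \<le> M * (1 + norm x)" for c
    using clamped_field_growth[of c] assms by (meson atLeastAtMost_iff order_trans)
qed (use that in \<open>auto simp: system_on_def\<close>)

text \<open>The clamped coefficients satisfy the inequalities at every state, so no continuity
  argument is needed here.\<close>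

lemma clamped_system_bound:
  assumes "clamped_system {t0..T} Y" "Y t0 = (a0, p0 t0 a0 * a1)" "t0 \<le> T"
  shows "\<bar>fst (Y T)\<bar> \<le> F T" "\<bar>snd (Y T)\<bar> \<le> \<bar>fst (Y T)\<bar> * V T"
  using assms by (auto intro!: system_estimate continuous_clamped p0 q0 clamped_majorized)

text \<open>The solution stays below \<open>F\<close>, where clamping changes nothing.\<close>

lemma system_if_clamped:
  assumes Y: "clamped_system {t0..} Y" and "Y t0 = (a0, p0 t0 a0 * a1)"
  shows "system_on p0 q0 r0 {t0..} Y"
proof -
  have "\<bar>fst (Y t)\<bar> \<le> F t + \<epsilon>" if "t \<in> {t0..}" for t
    using clamped_system_bound(1)[OF system_on_subset[OF Y, of "{t0..t}"] assms(2)] that \<epsilon> by auto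
  then show ?thesis
    using Y by (subst (asm) system_on_cong) (auto simp: clamped_eq)
qed

text \<open>In this direction the bound comes from \<open>system_bootstrap\<close>, which needs the
  solution on all of \<open>{t0..t}\<close>; hence the condition on \<open>J\<close>.\<close>

lemma clamped_if_system:
  assumes Y: "system_on p0 q0 r0 J Y" and "Y t0 = (a0, p0 t0 a0 * a1)"
    and J: "\<And>t. t \<in> J \<Longrightarrow> t \<ge> t0 \<and> {t0..t} \<subseteq> J"
  shows "clamped_system J Y"
proof -
  have "\<bar>fst (Y t)\<bar> \<le> F t + \<epsilon>" if "t \<in> J" for t
    using system_bootstrap[OF system_on_subset[OF Y] assms(2), of t t] J[OF that] by auto
  then show ?thesis
    using Y by (subst system_on_cong) (auto simp: clamped_eq)
qed

text \<open>The solution is regarded as one of the clamped system, carried to the right endpoint if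
  necessary, and continued from there by a global clamped solution. Only the glued curve, which
  starts from the initial data at \<open>t0\<close>, is turned back into a solution of the original
  system.\<close>

lemma system_extends:
  assumes Y: "system_on p0 q0 r0 J Y" and Y0: "Y t0 = (a0, p0 t0 a0 * a1)"
    and J: "right_interval t0 J"
  obtains Z where "system_on p0 q0 r0 {t0..} Z" "\<And>t. t \<in> J \<Longrightarrow> Z t = Y t"
proof -
  note result = that
  have extend: thesis if b: "t0 < b" and W: "clamped_system {t0..b} W" "\<And>t. t \<in> J \<Longrightarrow> W t = Y t"
    "J \<subseteq> {t0..b}" for b W
  proof -
    obtain Z where Z: "Z b = W b" "clamped_system {b..} Z"
      using clamped_system_exists[of b "W b"] b by auto
    let ?Z = "\<lambda>t. if t \<le> b then W t else Z t"
    have "clamped_system {t0..} ?Z"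
      using W(1) Z b by (intro system_on_glue) auto
    moreover have "t0 \<in> J"
      using J by (simp add: right_interval_def)
    then have "?Z t0 = (a0, p0 t0 a0 * a1)"
      using W(2) b Y0 by auto
    ultimately have "system_on p0 q0 r0 {t0..} ?Z"
      by (rule system_if_clamped)
    then show thesis
      using W(2,3) by (intro result[of ?Z]) auto
  qed
  from J show thesis
  proof (cases rule: right_interval_cases)
    case 1
    then show ?thesis
      using Y that by blast
  next
    case (2 b)
    have "clamped_system J Y"
      using Y Y0 by (rule clamped_if_system) (auto simp: 2)
    then show ?thesis
      using extend[of b Y] 2 by simp
  next
    case (3 b)
    have Yc: "clamped_system {t0..<b} Y"
      unfolding 3(2)[symmetric] using Y Y0 by (rule clamped_if_system) (auto simp: 3)
    \<comment> \<open>The a priori bounds on both components keep the curve in a bounded set, so its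
      velocity is bounded and the endpoint \<open>b\<close> can be added.\<close>
    obtain CF CV where C: "\<And>t. t \<in> {t0..b} \<Longrightarrow> \<bar>F t\<bar> \<le> CF" "\<And>t. t \<in> {t0..b} \<Longrightarrow> \<bar>V t\<bar> \<le> CV"
      using F_bounded[of b] V_bounded[of b] by blast
    have nY: "norm (Y t) \<le> CF + CF * CV" if t: "t \<in> {t0..<b}" for t
    proof -
      have "clamped_system {t0..t} Y" "t0 \<le> t"
        using t by (auto intro!: system_on_subset[OF Yc])
      note bd = clamped_system_bound[OF this(1) Y0 this(2)]
      have fst_le: "\<bar>fst (Y t)\<bar> \<le> CF"
        using bd(1) C(1)[of t] t by simp
      have "\<bar>snd (Y t)\<bar> \<le> \<bar>fst (Y t)\<bar> * \<bar>V t\<bar>"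
        using bd(2) by (rule order_trans) (simp add: mult_left_mono)
      also have "\<dots> \<le> CF * CV"
        using fst_le C(2)[of t] t by (intro mult_mono) auto
      finally show ?thesis
        using fst_le norm_Pair_le[of "fst (Y t)" "snd (Y t)"] by simp
    qed
    obtain M where M: "M \<ge> 0" "\<And>t z. t \<in> {t0..b} \<Longrightarrow> norm (clamped_field t z) \<le> M * (1 + norm z)"
      using clamped_field_growth[of b] by blast
    have "norm (clamped_field t (Y t)) \<le> M * (1 + (CF + CF * CV))" if "t \<in> {t0..<b}" for t
      using M(2)[of t "Y t"] mult_left_mono[OF add_left_mono[OF nY[OF that]] M(1), of 1] that by simp
    then obtain W where "clamped_system {t0..b} W" "\<And>t. t \<in> {t0..<b} \<Longrightarrow> W t = Y t"
      using system_on_extend_closed[OF Yc 3(1) continuous_clamped_field] by metis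
    then show ?thesis
      by (intro extend[of b W]) (auto simp: 3)
  qed
qed

section \<open>Return to the second-order equation\<close>

lemma ivp_solution_if_system:
  assumes Y: "system_on p0 q0 r0 {t0..} Y" and "Y t0 = (a0, p0 t0 a0 * a1)"
  shows "ivp_solution_on p0 q0 r0 t0 a0 a1 {t0..} (\<lambda>t. fst (Y t)) (\<lambda>t. snd (Y t) / p0 t (fst (Y t)))"
proof -
  have "right_interval t0 {t0..}"
    by (auto simp: right_interval_def is_interval_ci set_eq_iff intro!: exI[of _ "t0 + 1"])
  moreover have "solution_on p0 q0 r0 {t0..} (\<lambda>t. fst (Y t)) (\<lambda>t. snd (Y t) / p0 t (fst (Y t)))"
    using Y p0 q0 r0 p0_pos by (intro solution_on_if_system_on) auto
  ultimately show ?thesis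
    using assms(2) p0_pos[of t0 a0] by (simp add: ivp_solution_on_def)
qed

lemma system_if_ivp_solution:
  assumes "ivp_solution_on p0 q0 r0 t0 a0 a1 J \<phi> \<phi>'"
  shows "system_on p0 q0 r0 J (\<lambda>t. (\<phi> t, p0 t (\<phi> t) * \<phi>' t))"
  using assms p0_pos
  by (intro system_on_if_solution_on) (auto simp: ivp_solution_on_def right_interval_def)

text \<open>A solution on \<open>{t0..}\<close> is nonextendable because every right interval is
  contained in that half-line. Conversely, a solution on a smaller interval is extended by
  \<open>system_extends\<close>, so it is not maximal.\<close>

lemma exists_globally: "ivp_exists_globally p0 q0 r0 t0 a0 a1"
  unfolding ivp_exists_globally_def
proof (intro conjI allI impI)
  obtain Z where Z: "Z t0 = (a0, p0 t0 a0 * a1)" "clamped_system {t0..} Z"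
    using clamped_system_exists[of t0] by blast
  have "ivp_solution_on p0 q0 r0 t0 a0 a1 {t0..} (\<lambda>t. fst (Z t)) (\<lambda>t. snd (Z t) / p0 t (fst (Z t)))"
    using system_if_clamped[OF Z(2,1)] Z(1) by (rule ivp_solution_if_system)
  then have "nonextendable_ivp_solution_on p0 q0 r0 t0 a0 a1 {t0..} (\<lambda>t. fst (Z t)) (\<lambda>t. snd (Z t) / p0 t (fst (Z t)))"
    by (auto simp: nonextendable_ivp_solution_on_def ivp_solution_on_def right_interval_def)
  then show "\<exists>J \<phi> \<phi>'. nonextendable_ivp_solution_on p0 q0 r0 t0 a0 a1 J \<phi> \<phi>'"
    by blast
next
  fix J \<phi> \<phi>'
  assume "nonextendable_ivp_solution_on p0 q0 r0 t0 a0 a1 J \<phi> \<phi>'"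
  then have sol: "ivp_solution_on p0 q0 r0 t0 a0 a1 J \<phi> \<phi>'"
    and max: "\<And>J' \<rho> \<rho>'. J \<subset> J' \<Longrightarrow> ivp_solution_on p0 q0 r0 t0 a0 a1 J' \<rho> \<rho>' \<Longrightarrow> \<exists>t\<in>J. \<rho> t \<noteq> \<phi> t"
    unfolding nonextendable_ivp_solution_on_def by blast+
  then have J: "right_interval t0 J" and init: "\<phi> t0 = a0" "\<phi>' t0 = a1"
    by (simp_all add: ivp_solution_on_def)
  then have J0: "t0 \<in> J" "J \<subseteq> {t0..}"
    by (simp_all add: right_interval_def)
  obtain Z where Z: "system_on p0 q0 r0 {t0..} Z" "\<And>t. t \<in> J \<Longrightarrow> Z t = (\<phi> t, p0 t (\<phi> t) * \<phi>' t)"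
    using system_extends[OF system_if_ivp_solution[OF sol] _ J] init by auto
  have "ivp_solution_on p0 q0 r0 t0 a0 a1 {t0..} (\<lambda>t. fst (Z t)) (\<lambda>t. snd (Z t) / p0 t (fst (Z t)))"
    using Z J0 init by (intro ivp_solution_if_system) auto
  then show "J = {t0..}"
    using max[of "{t0..}" "\<lambda>t. fst (Z t)"] Z(2) J0(2) by auto
qed

text \<open>Applying the estimate on \<open>{t0..t}\<close> with varying right endpoint
  \<open>t\<close> gives monotonicity; \<open>\<phi>'\<close> does not vanish because
  \<open>p0 * \<phi>'\<close> does not.\<close>

lemma ivp_solution_estimate:
  assumes sol: "ivp_solution_on p0 q0 r0 t0 a0 a1 {t0..} \<phi> \<phi>'" and "t0 \<le> s" "s \<le> t"
  shows "0 < \<bar>\<phi> s\<bar>" "\<bar>\<phi> s\<bar> \<le> \<bar>\<phi> t\<bar>" "\<bar>\<phi> t\<bar> \<le> F t" "a1 \<noteq> 0 \<Longrightarrow> \<phi>' t \<noteq> 0"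
proof -
  let ?Y = "\<lambda>t. (\<phi> t, p0 t (\<phi> t) * \<phi>' t)"
  have Y0: "?Y t0 = (a0, p0 t0 a0 * a1)"
    using sol by (simp add: ivp_solution_on_def)
  have Y: "system_on p0 q0 r0 {t0..t} ?Y"
    using system_if_ivp_solution[OF sol] by (rule system_on_subset) auto
  have maj: "coeffs_majorized p0 q0 r0 \<tau> (fst (?Y \<tau>))" if "\<tau> \<in> {t0..t}" for \<tau>
    using system_bootstrap[OF Y Y0 that] coeffs[of \<tau> "\<phi> \<tau>"] that by (simp add: coeffs_majorized_def F_def)
  have "t0 \<le> t"
    using assms by simp
  note est = system_estimate[OF Y Y0 this p0 q0 maj]
  show "0 < \<bar>\<phi> s\<bar>" "\<bar>\<phi> s\<bar> \<le> \<bar>\<phi> t\<bar>"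
    using est(1)[of s] assms by auto
  show "\<bar>\<phi> t\<bar> \<le> F t"
    using est(2) by simp
  show "\<phi>' t \<noteq> 0" if "a1 \<noteq> 0"
    using est(4) that by simp
qed

end

theorem theorem3p1:
  fixes t0 a0 a1 \<epsilon> :: real
    and p0 q0 r0 :: "real \<Rightarrow> real \<Rightarrow> real"
    and P Q R :: "real \<Rightarrow> real"
  assumes "continuous_on ({t0..} \<times> UNIV) (\<lambda>(t, w). p0 t w)"
    and "continuous_on ({t0..} \<times> UNIV) (\<lambda>(t, w). q0 t w)"
    and "continuous_on ({t0..} \<times> UNIV) (\<lambda>(t, w). r0 t w)"
    and "\<And>t w. t \<ge> t0 \<Longrightarrow> p0 t w > 0"
    and "continuous_on {t0..} P" and "continuous_on {t0..} Q" and "continuous_on {t0..} R"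
    and "\<And>t. t \<ge> t0 \<Longrightarrow> P t > 0"
    and "a0 \<noteq> 0" and "a1 / a0 \<ge> 0"
    and "\<epsilon> > 0"
    and "\<And>t w. t \<ge> t0 \<Longrightarrow> \<bar>w\<bar> \<le> Fbound P Q R t0 t a0 (p0 t0 a0 * (a1 / a0)) + \<epsilon> \<Longrightarrow>
           p0 t w \<ge> P t \<and> q0 t w / p0 t w \<ge> Q t \<and> R t \<le> r0 t w \<and> r0 t w \<le> 0"
  shows "ivp_exists_globally p0 q0 r0 t0 a0 a1 \<and>
    (\<forall>\<phi> \<phi>'. ivp_solution_on p0 q0 r0 t0 a0 a1 {t0..} \<phi> \<phi>' \<longrightarrow>
       (\<forall>t\<ge>t0. \<bar>\<phi> t\<bar> > 0) \<and>
       mono_on {t0..} (\<lambda>t. \<bar>\<phi> t\<bar>) \<and>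
       (\<forall>t\<ge>t0. \<bar>\<phi> t\<bar> \<le> Fbound P Q R t0 t a0 (p0 t0 a0 * (a1 / a0))) \<and>
       (a1 \<noteq> 0 \<longrightarrow> (\<forall>t\<ge>t0. \<phi>' t \<noteq> 0)))"
proof -
  interpret riccati_majorant t0 a0 a1 \<epsilon> p0 q0 r0 P Q R
    by unfold_locales (use assms in blast)+
  show ?thesis
    using exists_globally ivp_solution_estimate by (auto simp: monotone_on_def F_def)
qed

end
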